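(* Let $d=d(n)=n/2-\eta$, where $\eta=\eta(n)$ satisfies $1/2\leq\eta\leq n/64$. Then the $d$-threshold for Hamiltonicity is $\eta/n^2$. That is: (0) there exists a sequence of $n$-vertex graphs $\{H_n\}_{n\in\mathbb{N}}$ with $\delta(H_n)\geq d$ such that, if $p=o(\eta/n^2)$, then $\lim_{n\to\infty}\mathbb{P}[H_n\cup G(n,p)\text{ is Hamiltonian}]=0$; and (1) for every sequence of $n$-vertex graphs $\{H_n\}_{n\in\mathbb{N}}$ with $\delta(H_n)\geq d$, if $p=\omega(\eta/n^2)$, then $\lim_{n\to\infty}\mathbb{P}[H_n\cup G(n,p)\text{ is Hamiltonian}]=1$.
   Context: All graphs are simple. $G(n,p)$ is the binomial random graph on the same $n$-vertex set as $H_n$, obtained by including each of the $\binom{n}{2}$ possible edges independently with probability $p$; $H_n\cup G(n,p)$ is the union of the edge sets. A graph is Hamiltonian if it contains a cycle through all its vertices. $\delta(\cdot)$ denotes minimum degree. Since $d$ is an integer, $\eta$ is an integer when $n$ is even and a half-integer when $n$ is odd. Asymptotic notation is as $n\to\infty$. *)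

theory Defs
  imports "HOL-Probability.Probability" "HOL-Library.Landau_Symbols"
begin

text \<open>A simple graph is a vertex set together with a set of two-element subsets of it.\<close>

definition all_edges :: "'a set \<Rightarrow> 'a set set" where
  "all_edges V = {e. e \<subseteq> V \<and> card e = 2}"

definition simple_graph :: "'a set \<Rightarrow> 'a set set \<Rightarrow> bool" where
  "simple_graph V E \<longleftrightarrow> finite V \<and> E \<subseteq> all_edges V"

definition vertex_degree :: "'a set set \<Rightarrow> 'a \<Rightarrow> nat" where
  "vertex_degree E v = card {e \<in> E. v \<in> e}"

text \<open>Only meaningful for finite nonempty \<open>V\<close>, since \<open>Min {}\<close> is unspecified.\<close>

definition min_degree :: "'a set \<Rightarrow> 'a set set \<Rightarrow> nat" where
  "min_degree V E = Min (vertex_degree E ` V)"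

text \<open>A cycle is given by the list of its vertices in cyclic order; the index \<open>mod\<close>
  the length yields the closing edge.\<close>

definition is_cycle :: "'a set set \<Rightarrow> 'a list \<Rightarrow> bool" where
  "is_cycle E c \<longleftrightarrow> 3 \<le> length c \<and> distinct c \<and>
     (\<forall>i<length c. {c ! i, c ! (Suc i mod length c)} \<in> E)"

definition hamiltonian :: "'a set \<Rightarrow> 'a set set \<Rightarrow> bool" where
  "hamiltonian V E \<longleftrightarrow> (\<exists>c. is_cycle E c \<and> set c = V)"

text \<open>The binomial random graph (as a distribution on edge sets): one independent
  Bernoulli trial per potential edge. Only meaningful for finite \<open>V\<close> and
  \<open>0 \<le> p \<le> 1\<close>.\<close>

definition binomial_random_graph :: "'a set \<Rightarrow> real \<Rightarrow> 'a set set pmf" where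
  "binomial_random_graph V p =
     map_pmf (\<lambda>f. {e \<in> all_edges V. f e})
       (Pi_pmf (all_edges V) False (\<lambda>_. bernoulli_pmf p))"

definition prob_union_hamiltonian :: "nat \<Rightarrow> nat set set \<Rightarrow> real \<Rightarrow> real" where
  "prob_union_hamiltonian n E p =
     measure_pmf.prob (binomial_random_graph {..<n} p) {R. hamiltonian {..<n} (E \<union> R)}"

end

theory Submission
  imports Defs
begin

text \<open>
  The lower bound is witnessed by the complete bipartite graph with parts of sizes \<open>d\<close> and \<open>n - d\<close>:
  a Hamilton cycle needs at least \<open>n - 2d = 2\<eta>\<close> random edges inside the larger part.

  For the upper bound, suppose first that \<open>H\<close> contains two disjoint sets of about \<open>d\<close> vertices without
  edges between them. Then \<open>H\<close> is almost the union of two cliques; both halves are Hamilton-connected,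
  and two disjoint random edges between them complete a Hamilton cycle. Otherwise extend
  \<open>H \<union> G(n,p)\<close> to an edge-maximal non-Hamiltonian graph \<open>F\<close>. Rotating a Hamilton path of \<open>F\<close> yields a
  cycle of length at least \<open>2d\<close>; since \<open>d\<close> is close to \<open>n/2\<close>, the vertices off a longest cycle are
  independent, and one such vertex together with the successors of its neighbours forms an
  independent set of size \<open>d + 1\<close> (as in Nash-Williams's theorem). The independent sets of \<open>H\<close> of this
  size fall into at most two classes of nearly equal sets, and all sets of a class are destroyed
  by a random matching of size \<open>2\<eta>\<close> inside a single representative. Such a matching exists with high
  probability, by a union bound over the possible maximal random matchings.
\<close>

section \<open>Paths and cycles\<close>

definition is_path :: "'a set set \<Rightarrow> 'a list \<Rightarrow> bool" where
  "is_path E P \<longleftrightarrow> distinct P \<and> successively (\<lambda>u v. {u, v} \<in> E) P"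

text \<open>No vertex set is mentioned: for \<open>E \<subseteq> all_edges V\<close> the neighbours
  lie in \<open>V\<close> and differ from \<open>v\<close>, since \<open>{v, v}\<close> is a
  singleton.\<close>

definition nbrs :: "'a set set \<Rightarrow> 'a \<Rightarrow> 'a set" where
  "nbrs E v = {u. {v, u} \<in> E}"

lemma finite_all_edges: "finite V \<Longrightarrow> finite (all_edges V)"
  unfolding all_edges_def by (rule finite_subset[of _ "Pow V"]) auto

lemma pair_in_all_edges: "{u, v} \<in> all_edges V \<longleftrightarrow> u \<in> V \<and> v \<in> V \<and> u \<noteq> v"
  unfolding all_edges_def by (auto simp: card_insert_if)

lemma all_edgesE:
  assumes "e \<in> all_edges V"
  obtains u v where "e = {u, v}" "u \<in> V" "v \<in> V" "u \<noteq> v"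
  using assms unfolding all_edges_def card_2_iff by auto

lemma in_nbrs: "u \<in> nbrs E v \<longleftrightarrow> {v, u} \<in> E"
  by (simp add: nbrs_def)

lemma nbrs_mono: "E \<subseteq> F \<Longrightarrow> nbrs E v \<subseteq> nbrs F v"
  by (auto simp: nbrs_def)

lemma nbrs_subset:
  assumes "E \<subseteq> all_edges V"
  shows "nbrs E v \<subseteq> V - {v}"
proof
  fix u assume "u \<in> nbrs E v"
  then have "{v, u} \<in> all_edges V" using assms by (auto simp: in_nbrs)
  then show "u \<in> V - {v}" by (auto simp: pair_in_all_edges)
qed

lemma vertex_degree_eq_card_nbrs:
  assumes "E \<subseteq> all_edges V"
  shows "vertex_degree E v = card (nbrs E v)"
proof -
  have "{e \<in> E. v \<in> e} = (\<lambda>u. {v, u}) ` nbrs E v"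
  proof (intro equalityI subsetI)
    fix e assume e: "e \<in> {e \<in> E. v \<in> e}"
    then obtain a b where "e = {a, b}" using assms by (blast elim: all_edgesE)
    with e show "e \<in> (\<lambda>u. {v, u}) ` nbrs E v"
      by (auto simp: nbrs_def insert_commute)
  qed (auto simp: nbrs_def)
  moreover have "inj_on (\<lambda>u. {v, u}) (nbrs E v)"
    by (auto simp: inj_on_def doubleton_eq_iff)
  ultimately show ?thesis unfolding vertex_degree_def by (simp add: card_image)
qed

section \<open>Paths under concatenation, and cycles as closed paths\<close>

lemma is_path_append:
  "is_path E (P @ Q) \<longleftrightarrow> is_path E P \<and> is_path E Q \<and> set P \<inter> set Q = {} \<and>
     (P = [] \<or> Q = [] \<or> {last P, hd Q} \<in> E)"
  unfolding is_path_def by (auto simp: successively_append_iff)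

lemma is_path_rev [simp]: "is_path E (rev P) \<longleftrightarrow> is_path E P"
  unfolding is_path_def by (simp add: insert_commute)

lemma is_path_take: "is_path E P \<Longrightarrow> is_path E (take k P)"
  by (metis append_take_drop_id is_path_append)

lemma is_path_drop: "is_path E P \<Longrightarrow> is_path E (drop k P)"
  by (metis append_take_drop_id is_path_append)

text \<open>Splits off the one index where \<open>mod\<close> wraps around. What remains is a path,
  so cycles can be assembled from paths with \<open>is_path_append\<close>.\<close>

lemma is_cycle_iff:
  "is_cycle E c \<longleftrightarrow> 3 \<le> length c \<and> is_path E c \<and> {last c, hd c} \<in> E"
proof (cases "3 \<le> length c")
  case True
  then obtain m where m: "length c = Suc m" by (cases "length c") auto
  have "(\<forall>i<length c. {c ! i, c ! (Suc i mod length c)} \<in> E) \<longleftrightarrow>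
     (\<forall>i<m. {c ! i, c ! (Suc i mod Suc m)} \<in> E) \<and> {c ! m, c ! 0} \<in> E"
    unfolding m All_less_Suc by auto
  moreover have "(\<forall>i<m. {c ! i, c ! (Suc i mod Suc m)} \<in> E) \<longleftrightarrow>
     (\<forall>i. Suc i < length c \<longrightarrow> {c ! i, c ! Suc i} \<in> E)"
    unfolding m by (metis Suc_less_eq mod_less)
  moreover have "last c = c ! m" "hd c = c ! 0"
    using m by (auto simp: last_conv_nth hd_conv_nth simp flip: length_greater_0_conv)
  ultimately show ?thesis
    using True unfolding is_cycle_def is_path_def successively_conv_nth by auto
qed (auto simp: is_cycle_def)

lemma is_cycle_rotate:
  assumes "is_cycle E c"
  shows "is_cycle E (rotate k c)"
proof -
  let ?m = "length c"
  have m: "?m > 0" and edge: "\<And>i. i < ?m \<Longrightarrow> {c ! i, c ! (Suc i mod ?m)} \<in> E"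
    using assms by (auto simp: is_cycle_def)
  have "{rotate k c ! i, rotate k c ! (Suc i mod ?m)} \<in> E" if "i < ?m" for i
  proof -
    have "rotate k c ! (Suc i mod ?m) = c ! (Suc ((k + i) mod ?m) mod ?m)"
      using m by (simp add: nth_rotate mod_simps)
    moreover have "rotate k c ! i = c ! ((k + i) mod ?m)"
      using that by (simp add: nth_rotate)
    ultimately show ?thesis using edge[of "(k + i) mod ?m"] m by simp
  qed
  then show ?thesis using assms by (simp add: is_cycle_def)
qed

section \<open>Edge-maximal extensions and the Hamilton paths they contain\<close>

lemma maximal_edge_set:
  assumes "finite V" "E \<subseteq> all_edges V" "\<not> Q E"
  obtains F where "E \<subseteq> F" "F \<subseteq> all_edges V" "\<not> Q F"
    "\<And>e. e \<in> all_edges V - F \<Longrightarrow> Q (insert e F)"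
proof -
  let ?S = "{F. E \<subseteq> F \<and> F \<subseteq> all_edges V \<and> \<not> Q F}"
  have "finite ?S"
    by (rule finite_subset[of _ "Pow (all_edges V)"]) (use assms finite_all_edges in auto)
  moreover have "E \<in> ?S" using assms by auto
  ultimately obtain F where F: "F \<in> ?S" "\<forall>G\<in>?S. F \<subseteq> G \<longrightarrow> F = G"
    by (metis (no_types, lifting) finite_has_maximal2)
  have "Q (insert e F)" if "e \<in> all_edges V - F" for e
  proof (rule ccontr)
    assume "\<not> Q (insert e F)"
    then have "insert e F \<in> ?S" using F(1) that by auto
    then have "F = insert e F" using F(2)[rule_format, of "insert e F"] by auto
    then show False using that by auto
  qed
  then show ?thesis using that[of F] F(1) by simp
qed

lemma is_path_complete:
  assumes "all_edges V \<subseteq> E" "distinct P" "set P \<subseteq> V"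
  shows "is_path E P"
  unfolding is_path_def successively_conv_nth
proof (intro conjI allI impI assms)
  fix i assume i: "Suc i < length P"
  then have "P ! i \<noteq> P ! Suc i" using assms by (simp add: nth_eq_iff_index_eq)
  then show "{P ! i, P ! Suc i} \<in> E"
    using assms i by (metis Suc_lessD nth_mem pair_in_all_edges subsetD)
qed

lemma hamiltonian_complete:
  assumes "finite V" "card V \<ge> 3" "all_edges V \<subseteq> E"
  shows "hamiltonian V E"
proof -
  obtain P where P: "set P = V" "distinct P" using finite_distinct_list[OF assms(1)] by blast
  have len: "length P \<ge> 3" using P assms(2) distinct_card by metis
  have "P \<noteq> []" using len by auto
  have "last P \<noteq> hd P"
    using len P \<open>P \<noteq> []\<close> by (simp add: last_conv_nth hd_conv_nth nth_eq_iff_index_eq)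
  then have "{last P, hd P} \<in> E"
    using \<open>P \<noteq> []\<close> assms(3) P by (metis hd_in_set last_in_set pair_in_all_edges subsetD)
  then show ?thesis
    using is_path_complete[OF assms(3) P(2)] len P unfolding hamiltonian_def is_cycle_iff by blast
qed

lemma is_path_insert_edge:
  assumes "is_path (insert {u, v} F) P" "\<And>i. Suc i < length P \<Longrightarrow> {P ! i, P ! Suc i} \<noteq> {u, v}"
  shows "is_path F P"
  using assms unfolding is_path_def successively_conv_nth by blast

text \<open>Any Hamilton cycle of the larger graph must use the new edge. Rotated so that this edge
  closes the list, the cycle becomes a Hamilton path of \<open>F\<close>.\<close>

lemma hamiltonian_insert_edge:
  assumes "hamiltonian V (insert {u, v} F)" "\<not> hamiltonian V F"
  obtains P where "is_path F P" "set P = V" "hd P = u" "last P = v"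
proof -
  obtain c where c: "is_cycle (insert {u, v} F) c" "set c = V"
    using assms(1) unfolding hamiltonian_def by blast
  let ?m = "length c"
  have m: "?m \<ge> 3" using c by (simp add: is_cycle_def)
  have "\<not> is_cycle F c" using c assms(2) unfolding hamiltonian_def by blast
  then obtain i where i: "i < ?m" "{c ! i, c ! (Suc i mod ?m)} = {u, v}"
    using c(1) unfolding is_cycle_def by blast
  define P where "P = rotate (Suc i) c"
  have P: "is_cycle (insert {u, v} F) P" "set P = V" "length P = ?m"
    using c by (auto simp: P_def simp del: rotate_Suc intro: is_cycle_rotate)
  have P0: "P \<noteq> []" using m P by auto
  have hd: "hd P = c ! (Suc i mod ?m)"
    unfolding P_def by (rule hd_rotate_conv_nth) (use m in auto)
  have "Suc i + (?m - 1) = i + ?m" using m by simp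
  then have "(Suc i + (?m - 1)) mod ?m = i" using i by simp
  then have last: "last P = c ! i"
    using m P P0 by (simp add: last_conv_nth P_def nth_rotate del: rotate_Suc)
  have uv: "{last P, hd P} = {u, v}" using i hd last by simp
  have dist: "distinct P" using P(1) by (simp add: is_cycle_def)
  have "is_path F P"
  proof (rule is_path_insert_edge)
    show "is_path (insert {u, v} F) P" using P(1) by (simp add: is_cycle_iff)
  next
    fix j assume j: "Suc j < length P"
    show "{P ! j, P ! Suc j} \<noteq> {u, v}"
    proof
      assume "{P ! j, P ! Suc j} = {u, v}"
      then have "{P ! j, P ! Suc j} = {P ! (?m - 1), P ! 0}"
        using uv P0 P(3) by (simp add: last_conv_nth hd_conv_nth)
      moreover have "?m - 1 < length P" "0 < length P" using m P(3) by auto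
      \<comment> \<open>By distinctness the closing pair could reappear inside the list only for a
        cycle of length 2, which \<open>m\<close> excludes.\<close>
      ultimately have "(j = ?m - 1 \<and> Suc j = 0) \<or> (j = 0 \<and> Suc j = ?m - 1)"
        using j dist nth_eq_iff_index_eq[OF dist] by (simp add: doubleton_eq_iff)
      then show False using m by auto
    qed
  qed
  moreover from uv have "hd P = u \<and> last P = v \<or> hd (rev P) = u \<and> last (rev P) = v"
    using P0 by (auto simp: doubleton_eq_iff hd_rev last_rev)
  ultimately show ?thesis using that[of P] that[of "rev P"] P(2) by auto
qed

text \<open>An edge-maximal non-Hamiltonian graph is not complete, and any missing edge would close
  a Hamilton cycle; removing it leaves the path \<open>P\<close>.\<close>

lemma nonhamiltonian_traceable_extension:
  assumes "finite V" "card V \<ge> 3" "E \<subseteq> all_edges V" "\<not> hamiltonian V E"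
  obtains F P where "E \<subseteq> F" "F \<subseteq> all_edges V" "\<not> hamiltonian V F" "is_path F P" "set P = V"
proof -
  obtain F where F: "E \<subseteq> F" "F \<subseteq> all_edges V" "\<not> hamiltonian V F"
    "\<And>e. e \<in> all_edges V - F \<Longrightarrow> hamiltonian V (insert e F)"
    using maximal_edge_set[of V E "hamiltonian V"] assms by metis
  obtain e where e: "e \<in> all_edges V - F" 
    using hamiltonian_complete[OF assms(1,2), of F] F(3) by blast
  then obtain u v where uv: "e = {u, v}" by (blast elim: all_edgesE)
  then have "hamiltonian V (insert {u, v} F)" using F(4) e by blast
  then obtain P where "is_path F P" "set P = V"
    using F(3) by (rule hamiltonian_insert_edge)
  then show ?thesis using that F by blast
qed

text \<open>The cycle follows \<open>P\<close> up to position \<open>s\<close>, jumps to the far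
  end, walks back to position \<open>t\<close> and returns to the start. It misses only the
  positions strictly between \<open>s\<close> and \<open>t\<close>, hence none if
  \<open>t = Suc s\<close>.\<close>

lemma cycle_of_path_overlap:
  assumes P: "is_path F P" and st: "s < t" "t < length P"
    and s: "P ! s \<in> nbrs F (last P)" and t: "P ! t \<in> nbrs F (hd P)"
    and len: "3 \<le> Suc s + (length P - t)"
  defines "c \<equiv> take (Suc s) P @ rev (drop t P)"
  shows "is_cycle F c" "length c = Suc s + (length P - t)" "set c \<subseteq> set P"
    "t = Suc s \<Longrightarrow> set c = set P"
proof -
  have 0: "P \<noteq> []" "drop t P \<noteq> []" using st by auto
  show l: "length c = Suc s + (length P - t)" using st by (simp add: c_def)
  show "set c \<subseteq> set P" unfolding c_def using set_take_subset set_drop_subset by fastforce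
  show "set c = set P" if "t = Suc s"
    unfolding c_def that by (metis append_take_drop_id set_append set_rev)
  have "set (take (Suc s) P) \<inter> set (drop t P) = {}"
    using P st unfolding is_path_def by (simp add: set_take_disj_set_drop_if_distinct)
  moreover have "last (take (Suc s) P) = P ! s" using st by (simp add: take_Suc_conv_app_nth)
  moreover have "hd (rev (drop t P)) = last P" using 0 by (simp add: hd_rev)
  ultimately have "is_path F c"
    unfolding c_def is_path_append using P s
    by (auto simp: is_path_take is_path_drop in_nbrs insert_commute)
  moreover have "last c = P ! t" using 0 st by (simp add: c_def last_rev hd_drop_conv_nth)
  moreover have "hd c = hd P" using 0 by (simp add: c_def)
  ultimately show "is_cycle F c"
    using t len l by (simp add: is_cycle_iff in_nbrs insert_commute)
qed

section \<open>Longest cycles and large independent sets\<close>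

definition separated :: "'a set set \<Rightarrow> 'a set \<Rightarrow> 'a set \<Rightarrow> bool" where
  "separated E X Y \<longleftrightarrow> X \<inter> Y = {} \<and> (\<forall>x\<in>X. \<forall>y\<in>Y. {x, y} \<notin> E)"

text \<open>The case \<open>u = v\<close> asks nothing of a simple graph, whose edges are never
  singletons.\<close>

definition independent_set :: "'a set set \<Rightarrow> 'a set \<Rightarrow> bool" where
  "independent_set E I \<longleftrightarrow> (\<forall>u\<in>I. \<forall>v\<in>I. {u, v} \<notin> E)"

text \<open>Neighbourhoods along a list become sets of indices, so that predecessors and successors
  are shifts and can be counted.\<close>

definition positions :: "'a list \<Rightarrow> 'a set \<Rightarrow> nat set" where
  "positions P S = {i. i < length P \<and> P ! i \<in> S}"

lemma finite_positions [simp]: "finite (positions P S)"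
  by (simp add: positions_def)

lemma nth_image_positions: "(!) P ` positions P S = set P \<inter> S"
  by (auto simp: positions_def in_set_conv_nth)

lemma card_positions:
  assumes "distinct P"
  shows "card (positions P S) = card (set P \<inter> S)"
proof -
  have "inj_on ((!) P) (positions P S)"
    using assms by (auto simp: positions_def inj_on_def nth_eq_iff_index_eq)
  then show ?thesis using nth_image_positions card_image by metis
qed

lemma card_positions_nbrs:
  assumes "distinct P" "set P = V" "F \<subseteq> all_edges V"
  shows "card (positions P (nbrs F v)) = card (nbrs F v)"
proof -
  have "set P \<inter> nbrs F v = nbrs F v" using assms(2) nbrs_subset[OF assms(3), of v] by auto
  then show ?thesis using card_positions assms(1) by metis
qed

section \<open>Crossing neighbourhoods of the two ends of a Hamilton path\<close>

lemma card_Suc_vimage: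
  assumes "0 \<notin> A"
  shows "card {i. Suc i \<in> A} = card A"
proof -
  have "A = Suc ` {i. Suc i \<in> A}"
    using assms by (auto simp: image_iff) (metis not0_implies_Suc)
  then show ?thesis by (metis card_image inj_Suc subset_UNIV inj_on_subset)
qed

text \<open>Of all the crossing pairs, the closest one yields a long cycle; non-Hamiltonicity enters
  by keeping \<open>X\<close> and \<open>N1\<close> disjoint.\<close>

lemma long_cycle_of_overlap:
  assumes F: "F \<subseteq> all_edges V" and ham: "\<not> hamiltonian V F"
    and deg: "\<And>v. v \<in> V \<Longrightarrow> d \<le> card (nbrs F v)" and d: "2 \<le> d"
    and P: "is_path F P" "set P = V"
    and overlap: "s0 < t0" "s0 \<in> positions P (nbrs F (last P))" "t0 \<in> positions P (nbrs F (hd P))"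
  shows "\<exists>c. is_cycle F c \<and> set c \<subseteq> V \<and> 2 * d \<le> length c"
proof -
  define N0 where "N0 = positions P (nbrs F (hd P))"
  define N1 where "N1 = positions P (nbrs F (last P))"
  define X where "X = {i. Suc i \<in> N0}"
  let ?n = "length P"
  have dist: "distinct P" using P by (simp add: is_path_def)
  have P0: "P \<noteq> []" using overlap by (auto simp: positions_def)
  then have ends: "hd P \<in> V" "last P \<in> V" using P(2) by auto
  have irrefl: "v \<notin> nbrs F v" for v using nbrs_subset[OF F, of v] by auto
  have "0 \<notin> N0" using irrefl[of "hd P"] P0 by (auto simp: N0_def positions_def hd_conv_nth)
  then have "card X = card N0" unfolding X_def by (rule card_Suc_vimage)
  then have cardX: "d \<le> card X"
    using card_positions_nbrs[OF dist P(2) F] deg[of "hd P"] ends by (simp add: N0_def)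
  have cardN1: "d \<le> card N1"
    using card_positions_nbrs[OF dist P(2) F] deg[of "last P"] ends by (simp add: N1_def)
  have "?n - 1 \<notin> N1"
    using irrefl[of "last P"] P0 by (auto simp: N1_def positions_def last_conv_nth)
  then have N1_sub: "N1 \<subseteq> {..<?n - 1}"
    by (auto simp: N1_def positions_def) (metis less_Suc_eq Suc_pred gr_zeroI not_less0)
  have X_sub: "X \<subseteq> {..<?n - 1}" by (auto simp: X_def N0_def positions_def)
  have "card N1 \<le> ?n - 1" using card_mono[OF _ N1_sub] by simp
  then have n3: "3 \<le> ?n" using cardN1 d by linarith
  \<comment> \<open>A common element would be a crossing pair at consecutive positions, hence a
    Hamilton cycle.\<close>
  have disj: "X \<inter> N1 = {}"
  proof (rule ccontr)
    assume "X \<inter> N1 \<noteq> {}"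
    then obtain i where i: "Suc i \<in> N0" "i \<in> N1" by (auto simp: X_def)
    then have i': "Suc i < ?n" "P ! i \<in> nbrs F (last P)" "P ! Suc i \<in> nbrs F (hd P)"
      by (auto simp: N0_def N1_def positions_def)
    have "3 \<le> Suc i + (?n - Suc i)" using n3 by simp
    note c = cycle_of_path_overlap(1,4)[OF P(1) lessI i' this]
    have "hamiltonian V F"
      unfolding hamiltonian_def using c(1) c(2)[OF refl] P(2) by blast
    with ham show False ..
  qed
  \<comment> \<open>For an overlapping pair with least gap, the skipped positions avoid \<open>X \<union> N1\<close>,
    which has at least \<open>2 * d\<close> elements.\<close>
  define D where "D = (\<lambda>(s, t). s \<in> N1 \<and> t \<in> N0 \<and> s < t)"
  have "D (s0, t0)" using overlap by (simp add: D_def N0_def N1_def)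
  then obtain z where z: "D z" "\<And>z'. D z' \<Longrightarrow> snd z - fst z \<le> snd z' - fst z'"
    using ex_has_least_nat[of D "(s0, t0)" "\<lambda>z. snd z - fst z"] by blast
  obtain s t where st: "z = (s, t)" by (cases z)
  have s: "s \<in> N1" and t: "t \<in> N0" and "s < t" using z(1) st by (auto simp: D_def)
  have least: "t - s \<le> t' - s'" if "s' \<in> N1" "t' \<in> N0" "s' < t'" for s' t'
    using z(2)[of "(s', t')"] that st by (simp add: D_def)
  have "t \<noteq> Suc s" using disj s t by (auto simp: X_def)
  then have st2: "Suc (Suc s) \<le> t" using \<open>s < t\<close> by simp
  have tn: "t < ?n" using t by (simp add: N0_def positions_def)
  \<comment> \<open>Position \<open>t - 1\<close> is left out because it lies in \<open>X\<close>.
    The one position lost is made up by \<open>length P - 1\<close>, which is in neither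
    \<open>X\<close> nor \<open>N1\<close>.\<close>
  let ?G = "{Suc s..<t - 1}"
  have "?G \<inter> X = {}"
  proof (rule ccontr)
    assume "?G \<inter> X \<noteq> {}"
    then obtain i where "Suc s \<le> i" "i < t - 1" "Suc i \<in> N0" by (auto simp: X_def)
    then show False using least[OF s, of "Suc i"] by auto
  qed
  moreover have "?G \<inter> N1 = {}"
  proof (rule ccontr)
    assume "?G \<inter> N1 \<noteq> {}"
    then obtain i where i: "Suc s \<le> i" "i < t - 1" "i \<in> N1" by auto
    then have "t - s \<le> t - i" using least[OF i(3) t] by simp
    then show False using i by linarith
  qed
  ultimately have "card (?G \<union> X \<union> N1) = card ?G + card X + card N1"
    using disj finite_subset[OF X_sub] finite_subset[OF N1_sub]
    by (subst card_Un_disjoint, auto)+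
  moreover have "card (?G \<union> X \<union> N1) \<le> card {..<?n - 1}"
    using X_sub N1_sub tn by (intro card_mono) auto
  ultimately have "(t - 1 - Suc s) + card X + card N1 \<le> ?n - 1" by simp
  then have "2 * d \<le> Suc s + (?n - t)" using cardX cardN1 st2 tn by linarith
  moreover have "P ! s \<in> nbrs F (last P)" "P ! t \<in> nbrs F (hd P)"
    using s t by (auto simp: N0_def N1_def positions_def)
  ultimately show ?thesis
    using cycle_of_path_overlap(1-3)[OF P(1) \<open>s < t\<close> tn] d P(2) by fastforce
qed

text \<open>Posa rotation: the edge from \<open>hd P\<close> to position \<open>Suc m\<close>
  replaces the edge between positions \<open>m\<close> and \<open>Suc m\<close>. The end and all
  positions from \<open>Suc m\<close> on stay fixed.\<close>

lemma rotated_path: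
  assumes "is_path F P" "Suc m < length P" "P ! Suc m \<in> nbrs F (hd P)"
  defines "Q \<equiv> rev (take (Suc m) P) @ drop (Suc m) P"
  shows "is_path F Q" "set Q = set P" "length Q = length P" "hd Q = P ! m" "last Q = last P"
    "\<And>i. Suc m \<le> i \<Longrightarrow> i < length P \<Longrightarrow> Q ! i = P ! i"
proof -
  have 0: "take (Suc m) P \<noteq> []" "drop (Suc m) P \<noteq> []" using assms(2) by auto
  show "set Q = set P" unfolding Q_def by (metis append_take_drop_id set_append set_rev)
  show "length Q = length P" using assms(2) by (simp add: Q_def)
  have "last (take (Suc m) P) = P ! m" using assms(2) by (simp add: take_Suc_conv_app_nth)
  then show "hd Q = P ! m" using 0 by (simp add: Q_def hd_rev)
  show "last Q = last P" using 0 by (simp add: Q_def)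
  show "Q ! i = P ! i" if "Suc m \<le> i" "i < length P" for i
    using that by (simp add: Q_def nth_append)
  have "last (rev (take (Suc m) P)) = hd P" using 0 by (simp add: last_rev)
  moreover have "hd (drop (Suc m) P) = P ! Suc m" using assms(2) by (simp add: hd_drop_conv_nth)
  moreover have "set (take (Suc m) P) \<inter> set (drop (Suc m) P) = {}"
    using assms(1) unfolding is_path_def by (simp add: set_take_disj_set_drop_if_distinct)
  ultimately show "is_path F Q"
    unfolding Q_def is_path_append using assms by (auto simp: is_path_take is_path_drop in_nbrs)
qed

text \<open>Every predecessor of a neighbour of \<open>hd P\<close> starts a rotated path with the same end, so the
  absence of overlaps applies to all of them at once.\<close>

lemma separated_of_no_overlap:
  assumes F: "F \<subseteq> all_edges V"
    and deg: "\<And>v. v \<in> V \<Longrightarrow> d \<le> card (nbrs F v)" and d: "1 \<le> d" and V: "V \<noteq> {}"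
    and P: "is_path F P" "set P = V"
    and no_overlap: "\<And>Q s t. \<lbrakk>is_path F Q; set Q = V; s < t; s \<in> positions Q (nbrs F (last Q));
       t \<in> positions Q (nbrs F (hd Q))\<rbrakk> \<Longrightarrow> False"
  shows "\<exists>X Y. X \<subseteq> V \<and> Y \<subseteq> V \<and> separated F X Y \<and> d \<le> card X \<and> d \<le> Suc (card Y)"
proof -
  define N0 where "N0 = positions P (nbrs F (hd P))"
  define N1 where "N1 = positions P (nbrs F (last P))"
  define j where "j = Min N1"
  let ?n = "length P"
  have dist: "distinct P" using P by (simp add: is_path_def)
  have P0: "P \<noteq> []" using P V by auto
  then have ends: "hd P \<in> V" "last P \<in> V" using P(2) by auto
  have irrefl: "v \<notin> nbrs F v" for v using nbrs_subset[OF F, of v] by auto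
  have "0 \<notin> N0" using irrefl[of "hd P"] P0 by (auto simp: N0_def positions_def hd_conv_nth)
  then have cardX: "d \<le> card {i. Suc i \<in> N0}"
    using card_positions_nbrs[OF dist P(2) F] deg[of "hd P"] ends card_Suc_vimage[of N0]
    by (simp add: N0_def)
  have cardN1: "d \<le> card N1"
    using card_positions_nbrs[OF dist P(2) F] deg[of "last P"] ends by (simp add: N1_def)
  have fin: "finite N1" by (simp add: N1_def)
  have j: "j \<in> N1" using Min_in[OF fin] cardN1 d unfolding j_def by fastforce
  have j_le: "j \<le> i" if "i \<in> N1" for i unfolding j_def using fin that by (rule Min_le)
  have ordered: "t \<le> s" if "s \<in> N1" "t \<in> N0" for s t
    using no_overlap[OF P, of s t] that by (force simp: N0_def N1_def)
  define X where "X = (!) P ` {i. Suc i \<in> N0}"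
  \<comment> \<open>Position \<open>j\<close> is sacrificed: it holds a neighbour of the end that
    precedes every position used for \<open>Y\<close> and will form an overlap with it.\<close>
  define Y where "Y = (!) P ` (N1 - {j})"
  have lt: "Suc i < ?n" if "Suc i \<in> N0" for i using that by (simp add: N0_def positions_def)
  have lt1: "i < ?n" if "i \<in> N1" for i using that by (simp add: N1_def positions_def)
  have "inj_on ((!) P) {i. Suc i \<in> N0}"
    using dist lt by (auto simp: inj_on_def nth_eq_iff_index_eq dest!: lt Suc_lessD)
  then have "d \<le> card X" using cardX by (simp add: X_def card_image)
  moreover have "inj_on ((!) P) (N1 - {j})"
    using dist lt1 by (auto simp: inj_on_def nth_eq_iff_index_eq)
  then have "card Y = card N1 - 1" using j by (simp add: Y_def card_image card_Diff_singleton)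
  then have "d \<le> Suc (card Y)" using cardN1 by simp
  moreover have "X \<subseteq> V" using lt P(2) by (auto simp: X_def intro!: nth_mem dest!: lt Suc_lessD)
  moreover have "Y \<subseteq> V" using lt1 P(2) by (auto simp: Y_def intro!: nth_mem)
  moreover have "x \<noteq> y \<and> {x, y} \<notin> F" if x: "x \<in> X" and y: "y \<in> Y" for x y
  proof -
    obtain m where m: "x = P ! m" "Suc m \<in> N0" using x by (auto simp: X_def)
    obtain q where q: "y = P ! q" "q \<in> N1" "q \<noteq> j" using y by (auto simp: Y_def)
    have mj: "Suc m \<le> j" using ordered[OF j m(2)] .
    have jq: "j < q" using j_le[OF q(2)] q(3) by simp
    have mn: "Suc m < ?n" "q < ?n" using lt[OF m(2)] lt1[OF q(2)] by auto
    have "x \<noteq> y" using m q mj jq mn dist by (simp add: nth_eq_iff_index_eq)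
    moreover have "{x, y} \<notin> F"
    proof
      assume xy: "{x, y} \<in> F"
      have "P ! Suc m \<in> nbrs F (hd P)" using m(2) by (simp add: N0_def positions_def)
      \<comment> \<open>Rotating makes \<open>x\<close> the head. Since
        \<open>Suc m <= j < q\<close>, positions \<open>j\<close> and \<open>q\<close> are
        untouched, and the edge \<open>{x, y}\<close> makes them overlap.\<close>
      note Q = rotated_path[OF P(1) mn(1) this]
      show False
      proof (rule no_overlap[OF Q(1) _ jq])
        show "j \<in> positions (rev (take (Suc m) P) @ drop (Suc m) P)
          (nbrs F (last (rev (take (Suc m) P) @ drop (Suc m) P)))"
          unfolding positions_def Q(5) using Q(3,6) mj j jq mn
          by (simp add: N1_def positions_def)
        show "q \<in> positions (rev (take (Suc m) P) @ drop (Suc m) P)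
          (nbrs F (hd (rev (take (Suc m) P) @ drop (Suc m) P)))"
          unfolding positions_def Q(4) using Q(3,6) mj jq mn xy m(1) q(1)
          by (simp add: in_nbrs)
      qed (use Q(2) P(2) in simp)
    qed
    ultimately show ?thesis ..
  qed
  then have "separated F X Y" unfolding separated_def by blast
  ultimately show ?thesis by blast
qed

text \<open>Once position \<open>i\<close> is last, an insertion after it amounts to appending to
  the list, as in \<open>cycle_extend\<close>.\<close>

lemma cycle_rotate_to:
  assumes "is_cycle F c" "i < length c"
  defines "r \<equiv> rotate (Suc i) c"
  shows "is_cycle F r" "set r = set c" "length r = length c" "last r = c ! i"
    "\<And>l. l < length c \<Longrightarrow> r ! l = c ! ((Suc i + l) mod length c)"
proof -
  show "is_cycle F r" unfolding r_def by (rule is_cycle_rotate[OF assms(1)])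
  show "set r = set c" "length r = length c" by (simp_all add: r_def)
  show nth: "r ! l = c ! ((Suc i + l) mod length c)" if "l < length c" for l
    unfolding r_def using that by (rule nth_rotate)
  have "r \<noteq> []" using assms(2) by (auto simp: r_def)
  then have "last r = r ! (length c - 1)" by (simp add: last_conv_nth r_def del: rotate_Suc)
  moreover have "Suc i + (length c - 1) = i + length c" using assms(2) by simp
  ultimately show "last r = c ! i" using nth[of "length c - 1"] assms(2) by simp
qed

lemma cycle_extend:
  assumes "is_cycle F c" "is_path F Q" "set Q \<inter> set c = {}" "Q \<noteq> []"
    "{last c, hd Q} \<in> F" "{last Q, hd c} \<in> F"
  shows "is_cycle F (c @ Q)"
proof -
  have "c \<noteq> []" using assms(1) by (auto simp: is_cycle_def)
  then show ?thesis using assms unfolding is_cycle_iff by (auto simp: is_path_append)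
qed

section \<open>Vertices off a longest cycle\<close>

locale longest_cycle =
  fixes F :: "'a set set" and c :: "'a list" and V :: "'a set"
  assumes cycle: "is_cycle F c"
    and longest: "\<And>c'. is_cycle F c' \<Longrightarrow> length c' \<le> length c"
    and edges: "F \<subseteq> all_edges V" and finite_V: "finite V" and sub: "set c \<subseteq> V"
begin

lemma length_ge: "3 \<le> length c" and distinct_c: "distinct c"
  using cycle by (auto simp: is_cycle_def)

lemma c_nonempty [simp]: "c \<noteq> []"
  using length_ge by auto

text \<open>Otherwise \<open>x\<close> could be inserted between the two consecutive
  vertices.\<close>

lemma no_consecutive_nbrs:
  assumes "x \<notin> set c" "i \<in> positions c (nbrs F x)"
  shows "Suc i mod length c \<notin> positions c (nbrs F x)"
proof
  assume s: "Suc i mod length c \<in> positions c (nbrs F x)"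
  have i: "i < length c" using assms by (simp add: positions_def)
  note r = cycle_rotate_to[OF cycle i]
  have "hd (rotate (Suc i) c) = c ! (Suc i mod length c)"
    using i by (intro hd_rotate_conv_nth) auto
  then have "is_cycle F (rotate (Suc i) c @ [x])"
    using assms s r by (intro cycle_extend) (auto simp: positions_def in_nbrs is_path_def insert_commute)
  then show False using longest r(3) by fastforce
qed

text \<open>Otherwise the pair \<open>x\<close>, \<open>y\<close> could be inserted between two
  consecutive cycle vertices, or could take the place of the one vertex between two vertices at
  distance two; both give a longer cycle.\<close>

lemma no_consecutive_nbrs2:
  assumes "x \<notin> set c" "y \<notin> set c" "{x, y} \<in> F" "i \<in> positions c (nbrs F x)"
  shows "Suc i mod length c \<notin> positions c (nbrs F y)"
    and "Suc (Suc i) mod length c \<notin> positions c (nbrs F y)"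
proof -
  have i: "i < length c" using assms by (simp add: positions_def)
  note r = cycle_rotate_to[OF cycle i]
  let ?r = "rotate (Suc i) c"
  have hd: "hd ?r = c ! (Suc i mod length c)"
    using i by (intro hd_rotate_conv_nth) auto
  have xy: "x \<noteq> y" using assms(3) edges pair_in_all_edges[of x y V] by blast
  have xc: "{c ! i, x} \<in> F" using assms(4) by (simp add: positions_def in_nbrs insert_commute)
  show "Suc i mod length c \<notin> positions c (nbrs F y)"
  proof
    assume s: "Suc i mod length c \<in> positions c (nbrs F y)"
    have "is_cycle F (?r @ [x, y])"
      using assms s r hd xy xc by (intro cycle_extend) (auto simp: positions_def in_nbrs is_path_def)
    then show False using longest r(3) by fastforce
  qed
  show "Suc (Suc i) mod length c \<notin> positions c (nbrs F y)"
  proof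
    assume s: "Suc (Suc i) mod length c \<in> positions c (nbrs F y)"
    \<comment> \<open>Here \<open>a\<close> is the vertex skipped by the new cycle
      \<open>(b # l) @ [x, y]\<close>, which is one longer than \<open>c\<close>.\<close>
    obtain a b l where abl: "?r = a # b # l"
      using r(3) length_ge by (cases ?r; cases "tl ?r") auto
    have "b = ?r ! 1" using abl by simp
    then have b: "b = c ! (Suc (Suc i) mod length c)" using r(5)[of 1] length_ge by simp
    have l: "l \<noteq> []" using abl r(3) length_ge by auto
    have sub': "set (b # l) \<subseteq> set c" using abl r(2) by auto
    have last: "last (b # l) = c ! i" using abl r(4) l by simp
    have path: "is_path F (b # l)"
      using r(1) unfolding abl by (auto simp: is_cycle_iff is_path_def)
    have yb: "{y, b} \<in> F" using s b by (simp add: positions_def in_nbrs)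
    have "is_path F [x, y]" using xy assms(3) by (simp add: is_path_def)
    moreover have "set (b # l) \<inter> set [x, y] = {}" using sub' assms(1,2) by auto
    ultimately have "is_path F ((b # l) @ [x, y])"
      using path last xc unfolding is_path_append by simp
    moreover have len: "length ((b # l) @ [x, y]) = Suc (length c)" using abl r(3) by simp
    ultimately have "is_cycle F ((b # l) @ [x, y])"
      using yb length_ge unfolding is_cycle_iff by simp
    then show False using longest len by fastforce
  qed
qed

lemma inj_shift: "inj_on (\<lambda>i. (i + k) mod length c) {..<length c}"
proof (rule inj_onI)
  fix i j assume ij: "i \<in> {..<length c}" "j \<in> {..<length c}"
    and eq: "(i + k) mod length c = (j + k) mod length c"
  then have "rotate k c ! i = rotate k c ! j" by (simp add: nth_rotate add.commute)
  then show "i = j" using ij distinct_c by (simp add: nth_eq_iff_index_eq)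
qed

text \<open>For an edge \<open>{x, y}\<close> off the cycle, the neighbour positions of
  \<open>x\<close> shifted by one, those shifted by two, and the neighbour positions of
  \<open>y\<close> are pairwise disjoint. Each set has at least
  \<open>d - (card V - length c)\<close> elements, which by \<open>long\<close> is too many for the
  \<open>length c\<close> positions.\<close>

lemma off_cycle_independent:
  assumes deg: "\<And>v. v \<in> V \<Longrightarrow> d \<le> card (nbrs F v)"
    and long: "3 * card V < 3 * d + 2 * length c"
  shows "independent_set F (V - set c)"
  unfolding independent_set_def
proof (intro ballI notI)
  fix x y assume x: "x \<in> V - set c" and y: "y \<in> V - set c" and xy: "{x, y} \<in> F"
  let ?m = "length c"
  let ?S = "\<lambda>v. positions c (nbrs F v)" and ?f = "\<lambda>k i. (i + k) mod ?m"
  have cardc: "card (set c) = ?m" using distinct_c by (rule distinct_card)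
  have m_le: "?m \<le> card V" using card_mono[OF finite_V sub] cardc by simp
  have card_S: "d \<le> card (?S v) + (card V - ?m)" if "v \<in> V" for v
  proof -
    have "nbrs F v \<subseteq> (set c \<inter> nbrs F v) \<union> (V - set c)" using nbrs_subset[OF edges, of v] by auto
    then have "card (nbrs F v) \<le> card ((set c \<inter> nbrs F v) \<union> (V - set c))"
      using finite_V by (intro card_mono) auto
    also have "\<dots> \<le> card (set c \<inter> nbrs F v) + card (V - set c)" by (rule card_Un_le)
    also have "card (V - set c) = card V - ?m" using sub cardc by (simp add: card_Diff_subset)
    finally show ?thesis using deg[OF that] card_positions[OF distinct_c] by (metis le_trans)
  qed
  have Slt: "?S v \<subseteq> {..<?m}" for v by (auto simp: positions_def)
  have card_shift: "card (?f k ` ?S v) = card (?S v)" for k v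
    using inj_on_subset[OF inj_shift Slt] by (rule card_image)
  have shift1: "?f 1 ` ?S x \<inter> ?S v = {}" if "v = x \<or> v = y" for v
    using that no_consecutive_nbrs no_consecutive_nbrs2(1) x y xy by auto
  have shift2: "?f 2 ` ?S x \<inter> ?S y = {}"
    using no_consecutive_nbrs2(2) x y xy by auto
  have "?f 2 i = ?f 1 (?f 1 i)" for i by (simp add: mod_simps)
  then have eq2: "?f 2 ` ?S x = ?f 1 ` ?f 1 ` ?S x" by (simp add: image_image)
  \<comment> \<open>This is the disjointness of \<open>?S x\<close> from its own shift, moved on by
    one more injective shift.\<close>
  have shift12: "?f 1 ` ?S x \<inter> ?f 2 ` ?S x = {}"
  proof -
    have "?f 1 ` ?S x \<subseteq> {..<?m}" using length_ge by auto
    then have "?f 1 ` (?S x \<inter> ?f 1 ` ?S x) = ?f 1 ` ?S x \<inter> ?f 1 ` ?f 1 ` ?S x"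
      using inj_on_image_Int[OF inj_shift[of 1] Slt[of x]] by blast
    then show ?thesis using shift1[of x] eq2 by auto
  qed
  have "card (?f 1 ` ?S x \<union> ?f 2 ` ?S x \<union> ?S y) = card (?S x) + card (?S x) + card (?S y)"
  proof -
    have "card (?f 1 ` ?S x \<union> ?f 2 ` ?S x) = card (?f 1 ` ?S x) + card (?f 2 ` ?S x)"
      using shift12 by (intro card_Un_disjoint) auto
    moreover have "card (?f 1 ` ?S x \<union> ?f 2 ` ?S x \<union> ?S y)
        = card (?f 1 ` ?S x \<union> ?f 2 ` ?S x) + card (?S y)"
      using shift1[of y] shift2 by (intro card_Un_disjoint) auto
    ultimately show ?thesis by (simp only: card_shift)
  qed
  moreover have "card (?f 1 ` ?S x \<union> ?f 2 ` ?S x \<union> ?S y) \<le> card {..<?m}"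
    using length_ge by (intro card_mono) (auto simp: positions_def)
  ultimately have "2 * card (?S x) + card (?S y) \<le> ?m" by simp
  moreover have "d \<le> card (?S x) + (card V - ?m)" "d \<le> card (?S y) + (card V - ?m)"
    using card_S x y by auto
  ultimately show False using long m_le by linarith
qed

text \<open>The set consists of \<open>x\<close> and the successors of its neighbours on the cycle.
  Two adjacent successors would allow a detour through \<open>x\<close> that keeps every vertex of
  the cycle.\<close>

lemma independent_successors:
  assumes x: "x \<in> V - set c" and nb: "nbrs F x \<subseteq> set c"
  shows "\<exists>I\<subseteq>V. independent_set F I \<and> card I = Suc (card (nbrs F x))"
proof -
  let ?m = "length c"
  let ?S = "positions c (nbrs F x)"
  define J where "J = (\<lambda>i. c ! (Suc i mod ?m)) ` ?S"
  have irrefl: "{v} \<notin> F" for v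
  proof
    assume "{v} \<in> F"
    then have "{v, v} \<in> all_edges V" using edges by auto
    then show False unfolding pair_in_all_edges by simp
  qed
  have J_sub: "J \<subseteq> set c" using length_ge by (auto simp: J_def)
  have Slt: "?S \<subseteq> {..<?m}" by (auto simp: positions_def)
  have "inj_on (\<lambda>i. (i + 1) mod ?m) ?S" using inj_on_subset[OF inj_shift Slt] .
  then have "inj_on (\<lambda>i. c ! (Suc i mod ?m)) ?S"
    using distinct_c length_ge by (auto simp: inj_on_def nth_eq_iff_index_eq)
  then have "card J = card (set c \<inter> nbrs F x)"
    using card_positions[OF distinct_c] by (simp add: J_def card_image)
  then have cardJ: "card J = card (nbrs F x)" using nb by (metis inf.absorb2)
  have xJ: "{x, u} \<notin> F" if "u \<in> J" for u
    using that no_consecutive_nbrs x length_ge by (auto simp: J_def positions_def in_nbrs)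
  have JJ: "{c ! (Suc i mod ?m), c ! (Suc j mod ?m)} \<notin> F" if i: "i \<in> ?S" and j: "j \<in> ?S" for i j
  proof
    assume uv: "{c ! (Suc i mod ?m), c ! (Suc j mod ?m)} \<in> F"
    then have ij: "i \<noteq> j" using irrefl by auto
    have im: "i < ?m" "j < ?m" using i j by (auto simp: positions_def)
    let ?r = "rotate (Suc i) c"
    note r = cycle_rotate_to[OF cycle im(1)]
    have r0: "?r \<noteq> []" using r(3) length_ge by auto
    have "c ! j \<in> set ?r" using r(2) im by simp
    then obtain l where l: "l < ?m" "?r ! l = c ! j" using r(3) by (metis in_set_conv_nth)
    have "?r ! (?m - 1) = c ! i" using r(3,4) r0 by (simp add: last_conv_nth del: rotate_Suc)
    then have "l \<noteq> ?m - 1" using l ij im distinct_c by (auto simp: nth_eq_iff_index_eq)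
    then have l': "Suc l < ?m" using l by simp
    have "c ! ((Suc i + l) mod ?m) = c ! j" using l r(5) by metis
    then have "(Suc i + l) mod ?m = j"
      using im distinct_c length_ge by (subst (asm) nth_eq_iff_index_eq) auto
    then have "Suc j mod ?m = (Suc i + Suc l) mod ?m" by (auto simp: mod_simps)
    then have rl': "?r ! Suc l = c ! (Suc j mod ?m)" using r(5)[OF l'] by simp
    \<comment> \<open>\<open>A\<close> runs from the successor of \<open>c ! i\<close> to
      \<open>c ! j\<close>, and \<open>B\<close> from the successor of \<open>c ! j\<close> to
      \<open>c ! i\<close>. With the edge from \<open>uv\<close>, the list
      \<open>rev A @ B @ [x]\<close> closes to a longer cycle.\<close>
    define A where "A = take (Suc l) ?r"
    define B where "B = drop (Suc l) ?r"
    have AB: "?r = A @ B" by (simp add: A_def B_def)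
    have A0: "A \<noteq> []" and B0: "B \<noteq> []" using l' r(3) r0 by (auto simp: A_def B_def simp del: rotate_Suc)
    have lastA: "last A = c ! j" using l' l r(3) by (simp add: A_def take_Suc_conv_app_nth del: rotate_Suc)
    have hdB: "hd B = c ! (Suc j mod ?m)"
      using l' r(3) rl' by (simp add: B_def hd_drop_conv_nth del: rotate_Suc)
    have hdA: "hd A = c ! (Suc i mod ?m)"
    proof -
      have "hd A = hd ?r" using AB A0 by simp
      also have "\<dots> = c ! (Suc i mod ?m)" using im by (intro hd_rotate_conv_nth) auto
      finally show ?thesis .
    qed
    have lastB: "last B = c ! i" using AB B0 r(4) by simp
    have paths: "is_path F A" "is_path F B" "set A \<inter> set B = {}"
      using r(1) unfolding is_cycle_iff AB is_path_append by auto
    have sets: "set A \<union> set B = set c" using r(2) AB by (metis set_append)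
    have "is_path F (rev A @ B)"
      unfolding is_path_append using paths uv hdA hdB A0 by (simp add: last_rev)
    moreover have "is_path F [x]" "set (rev A @ B) \<inter> set [x] = {}"
      using sets x by (auto simp: is_path_def)
    moreover have "{last (rev A @ B), hd [x]} \<in> F"
      using B0 lastB i by (simp add: positions_def in_nbrs insert_commute)
    ultimately have "is_path F ((rev A @ B) @ [x])"
      unfolding is_path_append[of F "rev A @ B"] by blast
    moreover have len: "length ((rev A @ B) @ [x]) = Suc ?m"
      using AB r(3) by (metis length_append length_append_singleton length_rev)
    moreover have "{last ((rev A @ B) @ [x]), hd ((rev A @ B) @ [x])} \<in> F"
      using A0 lastA j by (simp add: hd_rev positions_def in_nbrs)
    ultimately have "is_cycle F ((rev A @ B) @ [x])"
      using length_ge unfolding is_cycle_iff by simp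
    then show False using longest len by fastforce
  qed
  let ?I = "insert x J"
  have "independent_set F ?I"
    unfolding independent_set_def
  proof (intro ballI)
    fix u v assume "u \<in> ?I" "v \<in> ?I"
    then consider "u = x" "v = x" | "u = x" "v \<in> J" | "u \<in> J" "v = x" | "u \<in> J" "v \<in> J" by blast
    then show "{u, v} \<notin> F"
      using irrefl[of x] xJ[of v] xJ[of u] JJ
      by cases (simp, simp, simp add: insert_commute, auto simp: J_def)
  qed
  moreover have "card ?I = Suc (card (nbrs F x))"
    using J_sub x cardJ finite_subset[OF J_sub] by (subst card_insert_disjoint) auto
  moreover have "?I \<subseteq> V" using J_sub sub x by auto
  ultimately show ?thesis by blast
qed

end

text \<open>\<open>sep\<close> and \<open>indep\<close> speak of \<open>E\<close> only: separated
  and independent sets of the extension \<open>F\<close> are so in \<open>E\<close> as well. The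
  bound \<open>3 * card V < 7 * d\<close> is the one that \<open>off_cycle_independent\<close> asks
  for a cycle of length \<open>2 * d\<close>.\<close>

theorem hamiltonian_of_small_independence:
  assumes V: "finite V" and E: "E \<subseteq> all_edges V"
    and deg: "\<And>v. v \<in> V \<Longrightarrow> d \<le> card (nbrs E v)"
    and d: "3 * card V < 7 * d"
    and n: "7 \<le> card V"
    and sep: "\<And>X Y. \<lbrakk>X \<subseteq> V; Y \<subseteq> V; separated E X Y; d \<le> card X; d \<le> Suc (card Y)\<rbrakk> \<Longrightarrow> False"
    and indep: "\<And>I. \<lbrakk>I \<subseteq> V; independent_set E I\<rbrakk> \<Longrightarrow> card I \<le> d"
  shows "hamiltonian V E"
proof (rule ccontr)
  assume ham: "\<not> hamiltonian V E"
  have n3: "3 \<le> card V" using n by simp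
  obtain F P where F: "E \<subseteq> F" "F \<subseteq> all_edges V" "\<not> hamiltonian V F"
    and P: "is_path F P" "set P = V"
    by (rule nonhamiltonian_traceable_extension[OF V n3 E ham])
  have degF: "d \<le> card (nbrs F v)" if "v \<in> V" for v
  proof -
    have "finite (nbrs F v)" using nbrs_subset[OF F(2), of v] V by (meson finite_Diff finite_subset)
    then show ?thesis using deg[OF that] card_mono[OF _ nbrs_mono[OF F(1)]] by (meson le_trans)
  qed
  have d2: "2 \<le> d" using d n by linarith
  have "\<exists>c. is_cycle F c \<and> set c \<subseteq> V \<and> 2 * d \<le> length c"
  proof (rule ccontr)
    assume no: "\<not> ?thesis"
    have "\<exists>X Y. X \<subseteq> V \<and> Y \<subseteq> V \<and> separated F X Y \<and> d \<le> card X \<and> d \<le> Suc (card Y)"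
    proof (rule separated_of_no_overlap[OF F(2) degF _ _ P])
      fix Q s t assume "is_path F Q" "set Q = V" "s < t" "s \<in> positions Q (nbrs F (last Q))"
       "t \<in> positions Q (nbrs F (hd Q))"
      then show False using no long_cycle_of_overlap[OF F(2,3) degF d2, of Q s t] by simp
    qed (use d2 n in auto)
    then obtain X Y where XY: "X \<subseteq> V" "Y \<subseteq> V" "separated F X Y" "d \<le> card X" "d \<le> Suc (card Y)"
      by blast
    have "separated E X Y" using XY(3) F(1) unfolding separated_def by blast
    then show False using sep[OF XY(1,2) _ XY(4,5)] by simp
  qed
  then obtain c0 where c0: "is_cycle F c0" "set c0 \<subseteq> V" "2 * d \<le> length c0" by blast
  have in_V: "set c \<subseteq> V" if "is_cycle F c" for c
  proof
    fix v assume "v \<in> set c"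
    then obtain i where i: "i < length c" "v = c ! i" by (metis in_set_conv_nth)
    then have "{v, c ! (Suc i mod length c)} \<in> all_edges V"
      using that F(2) unfolding is_cycle_def by blast
    then show "v \<in> V" by (simp add: pair_in_all_edges)
  qed
  have bound: "length c \<le> card V" if "is_cycle F c" for c
    using card_mono[OF V in_V[OF that]] that by (simp add: is_cycle_def distinct_card)
  then obtain c where c: "is_cycle F c" "\<And>c'. is_cycle F c' \<Longrightarrow> length c' \<le> length c"
    using ex_has_greatest_nat[of "is_cycle F" c0 length "Suc (card V)"] c0(1)
    by (metis less_Suc_eq_le)
  interpret longest_cycle F c V
    using c F(2) V in_V[OF c(1)] by unfold_locales auto
  have "2 * d \<le> length c" using c(2)[OF c0(1)] c0(3) by simp
  then have ind: "independent_set F (V - set c)"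
    using off_cycle_independent[of d] degF d by simp
  have "set c \<noteq> V" using c(1) F(3) unfolding hamiltonian_def by blast
  then obtain x where x: "x \<in> V - set c" using sub by blast
  have "nbrs F x \<subseteq> set c"
  proof
    fix u assume u: "u \<in> nbrs F x"
    then have "u \<in> V" using nbrs_subset[OF F(2), of x] by auto
    then show "u \<in> set c" using u ind x unfolding independent_set_def in_nbrs by blast
  qed
  then obtain I where I: "I \<subseteq> V" "independent_set F I" "card I = Suc (card (nbrs F x))"
    using independent_successors[OF x] by blast
  have "independent_set E I" using I(2) F(1) unfolding independent_set_def by blast
  then have "card I \<le> d" by (rule indep[OF I(1)])
  then show False using I(3) degF[of x] x by simp
qed

section \<open>Hamilton-connected sets\<close>

definition spanning_path :: "'a set \<Rightarrow> 'a set set \<Rightarrow> 'a \<Rightarrow> 'a \<Rightarrow> bool" where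
  "spanning_path A E a b \<longleftrightarrow> (\<exists>P. is_path E P \<and> set P = A \<and> hd P = a \<and> last P = b)"

text \<open>The links after positions \<open>s\<close> and \<open>t\<close> are replaced by the two
  given edges, which reverses the stretch between them and fixes both ends. The link at
  \<open>s\<close> may be an edge missing from \<open>F\<close>.\<close>

lemma path_switch:
  assumes dist: "distinct P" and st: "s \<noteq> t" "Suc s < length P" "Suc t < length P"
    and edge: "\<And>i. Suc i < length P \<Longrightarrow> i \<noteq> s \<Longrightarrow> {P ! i, P ! Suc i} \<in> F"
    and s: "{P ! s, P ! t} \<in> F" and t: "{P ! Suc s, P ! Suc t} \<in> F"
  shows "spanning_path (set P) F (hd P) (last P)"
proof -
  \<comment> \<open>Either of \<open>s\<close> and \<open>t\<close> may come first; the construction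
    is symmetric in them.\<close>
  define lo where "lo = min s t"
  define hi where "hi = max s t"
  have lh: "lo < hi" "Suc hi < length P" "s = lo \<or> s = hi" using st by (auto simp: lo_def hi_def)
  have lo: "{P ! lo, P ! hi} \<in> F" "{P ! Suc lo, P ! Suc hi} \<in> F"
    using s t by (auto simp: lo_def hi_def min_def max_def insert_commute)
  define X where "X = take (Suc lo) P"
  define Y where "Y = drop (Suc lo) (take (Suc hi) P)"
  define Z where "Z = drop (Suc hi) P"
  have "take (Suc hi) P = X @ Y"
    unfolding X_def Y_def using lh by (metis append_take_drop_id min.absorb1 less_imp_le_nat Suc_le_mono take_take)
  then have XYZ: "P = X @ Y @ Z" unfolding Z_def by (metis append_assoc append_take_drop_id)
  have ne: "X \<noteq> []" "Y \<noteq> []" "Z \<noteq> []" using lh by (auto simp: X_def Y_def Z_def)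
  have "is_path F X"
    using dist edge lh by (auto simp: X_def is_path_def successively_conv_nth)
  moreover have "is_path F Y"
    using dist edge lh by (auto simp: Y_def is_path_def successively_conv_nth)
  moreover have "is_path F Z"
    using dist edge lh by (auto simp: Z_def is_path_def successively_conv_nth)
  moreover have "last X = P ! lo" using lh by (simp add: X_def take_Suc_conv_app_nth)
  moreover have "hd Y = P ! Suc lo" using lh by (simp add: Y_def hd_drop_conv_nth)
  moreover have "last Y = P ! hi" using lh by (simp add: Y_def last_conv_nth)
  moreover have "hd Z = P ! Suc hi" using lh by (simp add: Z_def hd_drop_conv_nth)
  moreover have "set X \<inter> set Y = {}" "set X \<inter> set Z = {}" "set Y \<inter> set Z = {}"
    using dist unfolding XYZ by auto
  ultimately have "is_path F (X @ rev Y @ Z)"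
    using ne lo unfolding is_path_append by (auto simp: hd_rev last_rev)
  moreover have "set (X @ rev Y @ Z) = set P" unfolding XYZ by simp
  moreover have "hd (X @ rev Y @ Z) = hd P" "last (X @ rev Y @ Z) = last P"
    unfolding XYZ using ne by simp_all
  ultimately show ?thesis unfolding spanning_path_def by blast
qed

text \<open>An Ore-type count. The spanning path uses the new edge at some position
  \<open>s\<close>; by \<open>path_switch\<close>, no \<open>t\<close> has position \<open>t\<close>
  adjacent to \<open>P ! s\<close> and position \<open>Suc t\<close> adjacent to
  \<open>P ! Suc s\<close>.\<close>

lemma degree_sum_of_nonedge:
  assumes F: "F \<subseteq> all_edges A" and ins: "spanning_path A (insert {u, v} F) a b"
    and no: "\<not> spanning_path A F a b"
  shows "card (nbrs F u) + card (nbrs F v) \<le> card A"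
proof -
  obtain P where P: "is_path (insert {u, v} F) P" "set P = A" "hd P = a" "last P = b"
    using ins unfolding spanning_path_def by blast
  have dist: "distinct P" using P(1) by (simp add: is_path_def)
  have lenP: "length P = card A" using distinct_card[OF dist] P(2) by simp
  have "\<not> is_path F P" using no P unfolding spanning_path_def by blast
  then obtain s where s: "Suc s < length P" "{P ! s, P ! Suc s} = {u, v}"
    using is_path_insert_edge[OF P(1)] by blast
  have edge: "{P ! i, P ! Suc i} \<in> F" if i: "Suc i < length P" "i \<noteq> s" for i
  proof -
    have "{P ! i, P ! Suc i} \<noteq> {P ! s, P ! Suc s}"
      using i s(1) dist by (auto simp: doubleton_eq_iff nth_eq_iff_index_eq)
    then show ?thesis using P(1) i(1) s(2) unfolding is_path_def successively_conv_nth by auto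
  qed
  let ?N0 = "positions P (nbrs F (P ! s))" and ?N1 = "positions P (nbrs F (P ! Suc s))"
  \<comment> \<open>Position \<open>length P - 1\<close> has no successor and \<open>0\<close> no
    predecessor. Dropping them costs at most one each, which the bound \<open>length P - 2\<close>
    makes up: both sets also avoid \<open>s\<close>.\<close>
  let ?X = "?N0 - {length P - 1}" and ?Y = "{i. Suc i \<in> ?N1 - {0}}"
  have irrefl: "w \<notin> nbrs F w" for w using nbrs_subset[OF F, of w] by auto
  have "?X \<inter> ?Y = {}"
  proof (rule ccontr)
    assume "?X \<inter> ?Y \<noteq> {}"
    then obtain t where t: "t \<in> ?N0" "Suc t \<in> ?N1" by auto
    then have "t \<noteq> s" using irrefl by (auto simp: positions_def)
    then have "spanning_path (set P) F (hd P) (last P)"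
      using t s edge by (intro path_switch[OF dist, of s t]) (auto simp: positions_def in_nbrs)
    then show False using no P(2-4) by simp
  qed
  moreover have sub: "?X \<subseteq> {..<length P - 1} - {s}" "?Y \<subseteq> {..<length P - 1} - {s}"
    using irrefl by (auto simp: positions_def)
  ultimately have "card ?X + card ?Y \<le> card ({..<length P - 1} - {s})"
    by (metis (no_types, lifting) Un_subset_iff card_Un_disjoint card_mono finite_Diff
        finite_lessThan finite_subset)
  also have "\<dots> = length P - 2" using s(1) by (simp add: card_Diff_singleton)
  finally have "card ?X + card ?Y \<le> length P - 2" .
  moreover have "card ?Y = card (?N1 - {0})" by (rule card_Suc_vimage) simp
  moreover have "card ?N0 - 1 \<le> card ?X" "card ?N1 - 1 \<le> card (?N1 - {0})"
    by (simp_all add: diff_card_le_card_Diff[of "{_}", simplified])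
  ultimately have "card ?N0 + card ?N1 \<le> card A" using s(1) lenP by linarith
  moreover have "card ?N0 = card (nbrs F (P ! s))" "card ?N1 = card (nbrs F (P ! Suc s))"
    using card_positions_nbrs[OF dist P(2) F] by auto
  ultimately show ?thesis using s(2) by (auto simp: doubleton_eq_iff)
qed

section \<open>Degree conditions for Hamilton-connectedness\<close>

lemma spanning_path_complete:
  assumes "finite A" "all_edges A \<subseteq> E" "a \<in> A" "b \<in> A" "a \<noteq> b"
  shows "spanning_path A E a b"
proof -
  obtain L where L: "set L = A - {a, b}" "distinct L"
    using finite_distinct_list[of "A - {a, b}"] assms(1) by blast
  have "is_path E (a # L @ [b])"
    using assms L by (intro is_path_complete[OF assms(2)]) auto
  then show ?thesis
    unfolding spanning_path_def using L assms by (intro exI[of _ "a # L @ [b]"]) auto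
qed

text \<open>A closure argument: in an edge-maximal counterexample \<open>F\<close>, nonadjacent
  vertices have degree sum at most \<open>card A\<close>. In turn this makes \<open>X\<close> a
  clique, joins \<open>X\<close> to all of \<open>A\<close>, and completes \<open>A\<close>, which
  then has the path.\<close>

lemma spanning_path_of_degrees:
  assumes A: "finite A" and E: "E \<subseteq> all_edges A" and X: "X \<subseteq> A"
    and degX: "\<And>x. x \<in> X \<Longrightarrow> card A < 2 * card (nbrs E x)"
    and degA: "\<And>r. r \<in> A \<Longrightarrow> card A + 2 \<le> card (nbrs E r) + card X"
    and cardX: "card A < 2 * card X"
    and ab: "a \<in> A" "b \<in> A" "a \<noteq> b"
  shows "spanning_path A E a b"
proof (rule ccontr)
  assume "\<not> ?thesis"
  then obtain F where F: "E \<subseteq> F" "F \<subseteq> all_edges A" "\<not> spanning_path A F a b"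
    "\<And>e. e \<in> all_edges A - F \<Longrightarrow> spanning_path A (insert e F) a b"
    using maximal_edge_set[OF A E, of "\<lambda>F. spanning_path A F a b"] by metis
  have fin: "finite (nbrs F v)" for v
    using nbrs_subset[OF F(2), of v] A by (meson finite_Diff finite_subset)
  have mono: "card (nbrs E v) \<le> card (nbrs F v)" for v
    by (rule card_mono[OF fin nbrs_mono[OF F(1)]])
  have nonedge: "card (nbrs F u) + card (nbrs F v) \<le> card A"
    if "u \<in> A" "v \<in> A" "u \<noteq> v" "{u, v} \<notin> F" for u v
  proof -
    have "{u, v} \<in> all_edges A - F" using that by (simp add: pair_in_all_edges)
    then show ?thesis using degree_sum_of_nonedge[OF F(2) F(4) F(3)] by simp
  qed
  have XX: "{x, y} \<in> F" if "x \<in> X" "y \<in> X" "x \<noteq> y" for x y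
  proof (rule ccontr)
    assume "{x, y} \<notin> F"
    then have "card (nbrs F x) + card (nbrs F y) \<le> card A"
      using nonedge[of x y] that X by auto
    then show False using degX[OF that(1)] degX[OF that(2)] mono[of x] mono[of y] by linarith
  qed
  have XA: "{x, r} \<in> F" if "x \<in> X" "r \<in> A" "x \<noteq> r" for x r
  proof (rule ccontr)
    assume "{x, r} \<notin> F"
    then have "card (nbrs F x) + card (nbrs F r) \<le> card A"
      using nonedge[of x r] that X by auto
    moreover have "X - {x} \<subseteq> nbrs F x"
    proof
      fix y assume "y \<in> X - {x}"
      then show "y \<in> nbrs F x" using XX[OF that(1), of y] by (auto simp: in_nbrs)
    qed
    then have "card (X - {x}) \<le> card (nbrs F x)" by (rule card_mono[OF fin])
    then have "card X - 1 \<le> card (nbrs F x)"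
      using that(1) finite_subset[OF X A] by (simp add: card_Diff_singleton)
    ultimately show False using degA[OF that(2)] mono[of r] by linarith
  qed
  have AA: "{r, q} \<in> F" if rq: "r \<in> A" "q \<in> A" "r \<noteq> q" for r q
  proof (cases "r \<in> X \<or> q \<in> X")
    case True
    then show ?thesis using XA[of r q] XA[of q r] rq by (auto simp: insert_commute)
  next
    case False
    have "X \<subseteq> nbrs F w" if "w \<in> A" "w \<notin> X" for w
    proof
      fix x assume x: "x \<in> X"
      with that have "x \<noteq> w" by auto
      then show "x \<in> nbrs F w" using XA[OF x that(1)] by (simp add: in_nbrs insert_commute)
    qed
    then have "X \<subseteq> nbrs F r" "X \<subseteq> nbrs F q" using False rq by auto
    then have "card X \<le> card (nbrs F r)" "card X \<le> card (nbrs F q)"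
      using card_mono[OF fin] by auto
    then show ?thesis using nonedge[OF rq] cardX by linarith
  qed
  have "all_edges A \<subseteq> F"
  proof
    fix e assume "e \<in> all_edges A"
    then obtain u v where "e = {u, v}" "u \<in> A" "v \<in> A" "u \<noteq> v" by (rule all_edgesE)
    then show "e \<in> F" using AA by simp
  qed
  then show False using spanning_path_complete[OF A _ ab] F(3) by simp
qed

section \<open>Splitting the vertex set along two separated sets\<close>

lemma is_path_mono: "is_path E P \<Longrightarrow> E \<subseteq> F \<Longrightarrow> is_path F P"
  unfolding is_path_def successively_conv_nth by auto

lemma spanning_path_mono: "spanning_path A E a b \<Longrightarrow> E \<subseteq> F \<Longrightarrow> spanning_path A F a b"
  unfolding spanning_path_def using is_path_mono[of E _ F] by auto

text \<open>The core \<open>S\<close> plays the role of \<open>X\<close> in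
  \<open>spanning_path_of_degrees\<close>. Its vertices have at most \<open>card R\<close>
  neighbours outside \<open>S\<close>, and those of \<open>A - S\<close> have at least half of
  \<open>d - card R\<close> neighbours in \<open>S\<close>; as \<open>R\<close> is small, both
  suffice.\<close>

lemma spanning_path_around_core:
  assumes V: "finite V" and E: "E \<subseteq> all_edges V"
    and deg: "\<And>v. v \<in> V \<Longrightarrow> d \<le> card (nbrs E v)"
    and S: "S \<subseteq> A" "A \<subseteq> V" and R: "R \<subseteq> V" "A - S \<subseteq> R"
    and nbS: "\<And>x. x \<in> S \<Longrightarrow> nbrs E x \<subseteq> S \<union> R"
    and nbR: "\<And>x. x \<in> A - S \<Longrightarrow> d \<le> 2 * card (nbrs E x \<inter> S) + card R"
    and cardR: "card R + 2 * d \<le> card V + 1"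
    and cardS: "d \<le> Suc (card S)"
    and cardA: "card A + d \<le> card V + 1"
    and d: "3 * card V + 8 \<le> 7 * d"
    and ab: "a \<in> A" "b \<in> A" "a \<noteq> b"
  shows "spanning_path A E a b"
proof -
  let ?E = "E \<inter> all_edges A"
  have finA: "finite A" and finS: "finite S" and finR: "finite R"
    using S R V finite_subset by metis+
  have nb: "nbrs ?E x = nbrs E x \<inter> A" if "x \<in> A" for x
    using that nbrs_subset[OF E, of x] by (auto simp: in_nbrs pair_in_all_edges)
  have degS: "d \<le> card (nbrs E x \<inter> S) + card R" if "x \<in> S" for x
  proof -
    have "nbrs E x \<subseteq> (nbrs E x \<inter> S) \<union> R" using nbS[OF that] by auto
    then have "card (nbrs E x) \<le> card ((nbrs E x \<inter> S) \<union> R)"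
      using finS finR by (intro card_mono) auto
    also have "\<dots> \<le> card (nbrs E x \<inter> S) + card R" by (rule card_Un_le)
    finally show ?thesis using deg[of x] that S by fastforce
  qed
  have S_le: "card (nbrs E x \<inter> S) \<le> card (nbrs ?E x)" if "x \<in> A" for x
    unfolding nb[OF that] using S finA by (intro card_mono) auto
  have "card A \<le> card (S \<union> R)" using S R finS finR by (intro card_mono) auto
  then have cardA': "card A \<le> card S + card R" using card_Un_le[of S R] by linarith
  have "spanning_path A ?E a b"
  proof (rule spanning_path_of_degrees[OF finA _ S(1) _ _ _ ab])
    show "?E \<subseteq> all_edges A" by simp
    show "card A < 2 * card (nbrs ?E x)" if "x \<in> S" for x
      using degS[OF that] S_le[of x] that S(1) cardR cardA d by fastforce
    \<comment> \<open>Since \<open>card A <= card S + card R\<close>, it is enough that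
      \<open>3 * card R + 4 <= d\<close>, which follows from \<open>cardR\<close> and the lower
      bound on \<open>d\<close>.\<close>
    show "card A + 2 \<le> card (nbrs ?E r) + card S" if r: "r \<in> A" for r
    proof -
      have "d \<le> 2 * card (nbrs E r \<inter> S) + card R"
        using nbR[of r] degS[of r] r by (cases "r \<in> S") auto
      then show ?thesis using S_le[OF r] cardA' cardR d by linarith
    qed
    show "card A < 2 * card S" using cardS cardA d by linarith
  qed
  then show ?thesis by (rule spanning_path_mono) simp
qed

text \<open>A vertex of the remainder \<open>R\<close> has at least \<open>d - card R\<close>
  neighbours in \<open>X \<union> Y\<close>, hence at least half as many in \<open>X\<close> or in
  \<open>Y\<close>, and joins such a side. Then \<open>spanning_path_around_core\<close> applies to
  both sides.\<close>

lemma partition_of_separated: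
  assumes V: "finite V" and E: "E \<subseteq> all_edges V"
    and deg: "\<And>v. v \<in> V \<Longrightarrow> d \<le> card (nbrs E v)"
    and d: "3 * card V + 8 \<le> 7 * d"
    and XY: "X \<subseteq> V" "Y \<subseteq> V" "separated E X Y" "d \<le> card X" "d \<le> Suc (card Y)"
  obtains A where "A \<subseteq> V" "d \<le> Suc (card A)" "d \<le> Suc (card (V - A))"
    "\<And>a b. a \<in> A \<Longrightarrow> b \<in> A \<Longrightarrow> a \<noteq> b \<Longrightarrow> spanning_path A E a b"
    "\<And>a b. a \<in> V - A \<Longrightarrow> b \<in> V - A \<Longrightarrow> a \<noteq> b \<Longrightarrow> spanning_path (V - A) E a b"
proof -
  define R where "R = V - (X \<union> Y)"
  define A where "A = X \<union> {r \<in> R. d \<le> 2 * card (nbrs E r \<inter> X) + card R}"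
  have disj: "X \<inter> Y = {}" and noXY: "\<And>x y. x \<in> X \<Longrightarrow> y \<in> Y \<Longrightarrow> {x, y} \<notin> E"
    using XY(3) by (auto simp: separated_def)
  have fin: "finite X" "finite Y" "finite R"
    using XY V finite_subset by (auto simp: R_def)
  have R: "R \<subseteq> V" "R \<inter> X = {}" "R \<inter> Y = {}" by (auto simp: R_def)
  have "card (X \<union> Y) = card X + card Y" using fin disj by (simp add: card_Un_disjoint)
  moreover have "card (X \<union> Y) \<le> card V" using XY V by (intro card_mono) auto
  moreover have "card R = card V - card (X \<union> Y)"
    unfolding R_def using XY fin by (intro card_Diff_subset) auto
  ultimately have cardR: "card R + 2 * d \<le> card V + 1" using XY(4,5) by linarith
  have AV: "A \<subseteq> V" and XA: "X \<subseteq> A" and YB: "Y \<subseteq> V - A"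
    using XY disj R by (auto simp: A_def)
  have cardXA: "card X \<le> card A" using XA AV V finite_subset by (metis card_mono)
  have cardYB: "card Y \<le> card (V - A)" using YB V by (intro card_mono) auto
  have cardAB: "card A + card (V - A) = card V"
    using AV V card_Diff_subset[of A V] card_mono[OF V AV] finite_subset[OF AV V] by simp
  have nbX: "nbrs E x \<subseteq> X \<union> R" if "x \<in> X" for x
    using nbrs_subset[OF E, of x] noXY[OF that] by (auto simp: R_def in_nbrs)
  have nbY: "nbrs E y \<subseteq> Y \<union> R" if "y \<in> Y" for y
    using nbrs_subset[OF E, of y] noXY[OF _ that] by (auto simp: R_def in_nbrs insert_commute)
  have nbR: "d \<le> 2 * card (nbrs E r \<inter> Y) + card R" if r: "r \<in> V - A - Y" for r
  proof -
    have "r \<in> R" using r by (auto simp: R_def A_def)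
    then have "2 * card (nbrs E r \<inter> X) + card R < d" using r by (auto simp: A_def)
    moreover have "nbrs E r \<subseteq> (nbrs E r \<inter> X) \<union> ((nbrs E r \<inter> Y) \<union> R)"
      using nbrs_subset[OF E, of r] by (auto simp: R_def)
    then have "card (nbrs E r) \<le> card ((nbrs E r \<inter> X) \<union> ((nbrs E r \<inter> Y) \<union> R))"
      using fin by (intro card_mono) auto
    then have "card (nbrs E r) \<le> card (nbrs E r \<inter> X) + (card (nbrs E r \<inter> Y) + card R)"
      using card_Un_le[of "nbrs E r \<inter> X" "(nbrs E r \<inter> Y) \<union> R"] card_Un_le[of "nbrs E r \<inter> Y" R]
      by linarith
    moreover have "d \<le> card (nbrs E r)" using deg r by simp
    ultimately show ?thesis by linarith
  qed
  show ?thesis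
  proof (rule that[OF AV])
    show "d \<le> Suc (card A)" "d \<le> Suc (card (V - A))" using cardXA cardYB XY(4,5) by auto
    show "spanning_path A E a b" if "a \<in> A" "b \<in> A" "a \<noteq> b" for a b
    proof (rule spanning_path_around_core[OF V E deg XA AV R(1) _ nbX _ cardR _ _ d that])
      show "card A + d \<le> card V + 1" using cardYB XY(5) cardAB by linarith
    qed (use XY(4) in \<open>auto simp: A_def\<close>)
    show "spanning_path (V - A) E a b" if "a \<in> V - A" "b \<in> V - A" "a \<noteq> b" for a b
    proof (rule spanning_path_around_core[OF V E deg YB _ R(1) _ nbY nbR cardR XY(5) _ d that])
      show "V - A - Y \<subseteq> R" by (auto simp: A_def R_def)
      show "card (V - A) + d \<le> card V + 1" using cardXA XY(4) cardAB by linarith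
    qed auto
  qed
qed

lemma hamiltonian_of_partition:
  assumes "spanning_path A E a1 a2" "spanning_path B E b2 b1" "A \<inter> B = {}" "A \<union> B = V"
    "a1 \<in> A" "b1 \<in> B" "{a1, b1} \<in> E" "{a2, b2} \<in> E" "3 \<le> card V"
  shows "hamiltonian V E"
proof -
  obtain P where P: "is_path E P" "set P = A" "hd P = a1" "last P = a2"
    using assms(1) unfolding spanning_path_def by blast
  obtain Q where Q: "is_path E Q" "set Q = B" "hd Q = b2" "last Q = b1"
    using assms(2) unfolding spanning_path_def by blast
  have ne: "P \<noteq> []" "Q \<noteq> []" using P Q assms by auto
  have path: "is_path E (P @ Q)" using P Q assms by (simp add: is_path_append)
  have set: "set (P @ Q) = V" using P Q assms by simp
  have "length (P @ Q) = card V" using path set distinct_card[of "P @ Q"] unfolding is_path_def by simp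
  then have "is_cycle E (P @ Q)"
    unfolding is_cycle_iff using path ne P Q assms by (simp add: insert_commute)
  then show ?thesis using set unfolding hamiltonian_def by blast
qed

section \<open>Matchings in the binomial random graph\<close>

lemma card_all_edges: "finite V \<Longrightarrow> card (all_edges V) = card V choose 2"
  unfolding all_edges_def by (rule n_subsets)

lemma all_edges_mono: "V \<subseteq> W \<Longrightarrow> all_edges V \<subseteq> all_edges W"
  unfolding all_edges_def by auto

lemma real_choose_2: "real (n choose 2) = real n * (real n - 1) / 2"
proof (induction n)
  case (Suc n)
  have "Suc n choose 2 = n + (n choose 2)" by (simp add: numeral_2_eq_2)
  then show ?case using Suc by (simp add: field_simps)
qed (simp add: numeral_2_eq_2)

lemma prob_contains_avoids:
  assumes V: "finite V" and p: "0 \<le> p" "p \<le> 1"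
    and AB: "A \<subseteq> all_edges V" "B \<subseteq> all_edges V" "A \<inter> B = {}"
  shows "measure_pmf.prob (binomial_random_graph V p) {R. A \<subseteq> R \<and> B \<inter> R = {}}
    = p ^ card A * (1 - p) ^ card B"
proof -
  let ?S = "all_edges V"
  \<comment> \<open>The outcomes allowed to each edge, so that the event becomes a product
    set.\<close>
  define C where "C = (\<lambda>e. if e \<in> A then {True} else if e \<in> B then {False} else UNIV)"
  have notA: "e \<notin> A" if "e \<in> B" for e using AB(3) that by auto
  have fin: "finite ?S" by (rule finite_all_edges[OF V])
  have "measure_pmf.prob (binomial_random_graph V p) {R. A \<subseteq> R \<and> B \<inter> R = {}}
    = measure_pmf.prob (Pi_pmf ?S False (\<lambda>_. bernoulli_pmf p))
        ((\<lambda>f. {e \<in> ?S. f e}) -` {R. A \<subseteq> R \<and> B \<inter> R = {}})"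
    unfolding binomial_random_graph_def by (rule measure_map_pmf)
  also have "(\<lambda>f. {e \<in> ?S. f e}) -` {R. A \<subseteq> R \<and> B \<inter> R = {}} = Pi ?S C"
  proof (rule set_eqI)
    fix f
    have "f \<in> Pi ?S C \<longleftrightarrow> (\<forall>e\<in>?S. (e \<in> A \<longrightarrow> f e) \<and> (e \<in> B \<longrightarrow> \<not> f e))"
      using notA by (auto simp: C_def Pi_iff)
    also have "\<dots> \<longleftrightarrow> f \<in> (\<lambda>f. {e \<in> ?S. f e}) -` {R. A \<subseteq> R \<and> B \<inter> R = {}}"
      using AB(1,2) by auto
    finally show "f \<in> (\<lambda>f. {e \<in> ?S. f e}) -` {R. A \<subseteq> R \<and> B \<inter> R = {}} \<longleftrightarrow> f \<in> Pi ?S C" ..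
  qed
  also have "measure_pmf.prob (Pi_pmf ?S False (\<lambda>_. bernoulli_pmf p)) (Pi ?S C)
    = (\<Prod>e\<in>?S. measure_pmf.prob (bernoulli_pmf p) (C e))"
    by (rule measure_Pi_pmf_Pi[OF fin])
  also have "\<dots> = (\<Prod>e\<in>?S. (if e \<in> A then p else 1) * (if e \<in> B then 1 - p else 1))"
    using notA p by (intro prod.cong refl) (auto simp: C_def measure_pmf_single)
  also have "\<dots> = (\<Prod>e\<in>A. p) * (\<Prod>e\<in>B. 1 - p)"
    using AB fin by (simp add: prod.distrib prod.If_cases Int_absorb1)
  finally show ?thesis by simp
qed

section \<open>Matchings by a union bound\<close>

lemma sum_power_card_Pow:
  fixes x :: real
  assumes "finite S"
  shows "(\<Sum>M\<in>Pow S. x ^ card M) = (1 + x) ^ card S"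
  using prod_add[OF assms, of "\<lambda>_. x" "\<lambda>_. 1"] by (simp add: add.commute)

text \<open>If there is no matching of size \<open>k\<close>, then some matching \<open>M\<close> with fewer than \<open>k\<close> edges is present
  while all edges disjoint from it are absent. In the union bound over \<open>M\<close>, the factor \<open>(2 * K) ^ k\<close>
  pays for damping the edge weights from \<open>p\<close> to \<open>p / (2 * K)\<close>.\<close>

lemma prob_no_matching:
  assumes V: "finite V" and p: "0 \<le> p" "p \<le> 1" and S: "S \<subseteq> all_edges V"
    and K: "1 \<le> K" "real (card S) \<le> K * N"
    and N: "\<And>M. \<lbrakk>M \<subseteq> S; disjoint M; card M < k\<rbrakk> \<Longrightarrow> N \<le> real (card {e \<in> S. e \<inter> \<Union>M = {}})"
  shows "measure_pmf.prob (binomial_random_graph V p)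
      {R. \<not> (\<exists>M \<subseteq> S \<inter> R. disjoint M \<and> card M = k)} \<le> (2 * K) ^ k * exp (- p * N / 2)"
proof -
  let ?P = "measure_pmf.prob (binomial_random_graph V p)"
  define D where "D = (\<lambda>M. {e \<in> S. e \<inter> \<Union>M = {}})"
  define MM where "MM = {M. M \<subseteq> S \<and> disjoint M \<and> card M < k}"
  have finS: "finite S" using S finite_all_edges[OF V] by (rule finite_subset)
  have finMM: "finite MM"
    by (rule finite_subset[of _ "Pow S"]) (auto simp: MM_def finS)
  have ne: "e \<noteq> {}" if "e \<in> S" for e
    using that S by (auto simp: all_edges_def)
  have "{R. \<not> (\<exists>M \<subseteq> S \<inter> R. disjoint M \<and> card M = k)} \<subseteq> (\<Union>M\<in>MM. {R. M \<subseteq> R \<and> D M \<inter> R = {}})"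
  proof
    fix R assume "R \<in> {R. \<not> (\<exists>M \<subseteq> S \<inter> R. disjoint M \<and> card M = k)}"
    then have R: "\<And>M. M \<subseteq> S \<inter> R \<Longrightarrow> disjoint M \<Longrightarrow> card M \<noteq> k" by blast
    let ?F = "{M. M \<subseteq> S \<inter> R \<and> disjoint M}"
    have "finite ?F" by (rule finite_subset[of _ "Pow S"]) (auto simp: finS)
    moreover have "{} \<in> ?F" by simp
    ultimately obtain M where M: "M \<in> ?F" "\<forall>M'\<in>?F. M \<subseteq> M' \<longrightarrow> M = M'"
      by (metis (no_types, lifting) finite_has_maximal2)
    have "card M < k"
    proof (rule ccontr)
      assume "\<not> card M < k"
      then obtain T where T: "T \<subseteq> M" "card T = k"
        using obtain_subset_with_card_n[of k M] by (metis not_less)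
      then have "disjoint T" "T \<subseteq> S \<inter> R" using M(1) by (auto intro: pairwise_subset)
      then show False using R T(2) by simp
    qed
    then have "M \<in> MM" using M(1) by (auto simp: MM_def)
    moreover have "D M \<inter> R = {}"
    proof (rule ccontr)
      assume "D M \<inter> R \<noteq> {}"
      then obtain e where e: "e \<in> S" "e \<inter> \<Union>M = {}" "e \<in> R" by (auto simp: D_def)
      have "disjoint (insert e M)"
        using M(1) e(2) by (auto simp: pairwise_insert disjnt_def)
      then have "M = insert e M"
        using M(2)[rule_format, of "insert e M"] M(1) e by auto
      then have "e \<in> M" by auto
      then show False using e(1,2) ne[of e] by auto
    qed
    ultimately show "R \<in> (\<Union>M\<in>MM. {R. M \<subseteq> R \<and> D M \<inter> R = {}})" using M(1) by auto
  qed
  then have "?P {R. \<not> (\<exists>M \<subseteq> S \<inter> R. disjoint M \<and> card M = k)}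
      \<le> ?P (\<Union>M\<in>MM. {R. M \<subseteq> R \<and> D M \<inter> R = {}})"
    by (rule measure_pmf.finite_measure_mono) simp
  also have "\<dots> \<le> (\<Sum>M\<in>MM. ?P {R. M \<subseteq> R \<and> D M \<inter> R = {}})"
    by (rule measure_pmf.finite_measure_subadditive_finite[OF finMM]) simp
  also have "\<dots> \<le> (\<Sum>M\<in>MM. (2 * K) ^ k * exp (- p * N) * (p / (2 * K)) ^ card M)"
  proof (rule sum_mono)
    fix M assume "M \<in> MM"
    then have M: "M \<subseteq> S" "disjoint M" "card M < k" by (auto simp: MM_def)
    have "M \<inter> D M = {}" using ne M(1) by (auto simp: D_def)
    then have eq: "?P {R. M \<subseteq> R \<and> D M \<inter> R = {}} = p ^ card M * (1 - p) ^ card (D M)"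
      using M(1) S by (intro prob_contains_avoids[OF V p]) (auto simp: D_def)
    have "(1 - p) ^ card (D M) \<le> exp (- p) ^ card (D M)"
      using p exp_ge_add_one_self[of "- p"] by (intro power_mono) auto
    also have "\<dots> = exp (- p * real (card (D M)))"
      by (simp add: exp_of_nat_mult[symmetric] mult.commute)
    also have "\<dots> \<le> exp (- p * N)"
      using N[OF M] p by (simp add: D_def mult_left_mono)
    finally have le1: "(1 - p) ^ card (D M) \<le> exp (- p * N)" .
    have "p ^ card M = (2 * K) ^ card M * (p / (2 * K)) ^ card M"
      using K(1) by (simp add: power_divide)
    also have "\<dots> \<le> (2 * K) ^ k * (p / (2 * K)) ^ card M"
      using K(1) M(3) p by (intro mult_right_mono power_increasing) auto
    finally have le2: "p ^ card M \<le> (2 * K) ^ k * (p / (2 * K)) ^ card M" .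
    have "p ^ card M * (1 - p) ^ card (D M) \<le> ((2 * K) ^ k * (p / (2 * K)) ^ card M) * exp (- p * N)"
      using le1 le2 p K(1) by (intro mult_mono) auto
    then show "?P {R. M \<subseteq> R \<and> D M \<inter> R = {}}
        \<le> (2 * K) ^ k * exp (- p * N) * (p / (2 * K)) ^ card M"
      using eq by (simp add: mult_ac)
  qed
  \<comment> \<open>Over all subsets of \<open>S\<close> the sum is a binomial expansion.\<close>
  also have "\<dots> \<le> (\<Sum>M\<in>Pow S. (2 * K) ^ k * exp (- p * N) * (p / (2 * K)) ^ card M)"
    using p K(1) finS by (intro sum_mono2) (auto simp: MM_def)
  also have "\<dots> = (2 * K) ^ k * exp (- p * N) * (1 + p / (2 * K)) ^ card S"
    by (simp add: sum_distrib_left[symmetric] sum_power_card_Pow[OF finS])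
  \<comment> \<open>As \<open>card S <= K * N\<close>, the damped weights cost only half of the
    exponent gained from the absent edges.\<close>
  also have "\<dots> \<le> (2 * K) ^ k * exp (- p * N) * exp (p * N / 2)"
  proof -
    have "(1 + p / (2 * K)) ^ card S \<le> exp (p / (2 * K)) ^ card S"
      using p K(1) exp_ge_add_one_self[of "p / (2 * K)"] by (intro power_mono) auto
    also have "\<dots> = exp (p / (2 * K) * real (card S))"
      by (simp add: exp_of_nat_mult[symmetric] mult.commute)
    also have "\<dots> \<le> exp (p * N / 2)"
    proof -
      have "p * real (card S) \<le> p * (K * N)" using K(2) p by (intro mult_left_mono) auto
      then show ?thesis using K(1) by (simp add: field_simps)
    qed
    finally show ?thesis using K(1) by (intro mult_left_mono) auto
  qed
  also have "\<dots> = (2 * K) ^ k * exp (- p * N / 2)"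
    by (simp add: exp_add[symmetric])
  finally show ?thesis .
qed

lemma card_Union_edges:
  assumes "M \<subseteq> all_edges V"
  shows "card (\<Union>M) \<le> 2 * card M"
proof -
  have "card (\<Union>M) \<le> sum card M"  by (rule card_Union_le_sum_card)
  also have "\<dots> = (\<Sum>e\<in>M. 2)" using assms by (intro sum.cong) (auto simp: all_edges_def)
  finally show ?thesis by simp
qed

text \<open>Fewer than \<open>k\<close> edges cover at most \<open>2 * k\<close> vertices, so at
  least \<open>card V / 4 + 1\<close> vertices of \<open>W\<close> remain; these span at least
  \<open>(card V)^2 / 32\<close> potential edges.\<close>

lemma prob_no_matching_clique:
  assumes V: "finite V" and p: "0 \<le> p" "p \<le> 1" and W: "W \<subseteq> V"
    and W_large: "real (card V) / 4 + 1 \<le> real (card W) - 2 * real k"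
  shows "measure_pmf.prob (binomial_random_graph V p)
      {R. \<not> (\<exists>M \<subseteq> all_edges W \<inter> R. disjoint M \<and> card M = k)}
    \<le> 64 ^ k * exp (- p * (real (card V))\<^sup>2 / 64)"
proof -
  let ?n = "real (card V)"
  have finW: "finite W" using W V by (rule finite_subset)
  have cardW: "card W \<le> card V" using V W by (rule card_mono)
  \<comment> \<open>With \<open>K = 32\<close> and \<open>N = ?n^2 / 32\<close>, the product
    \<open>K * N = ?n^2\<close> trivially bounds the number of edges; \<open>64\<close> is
    \<open>2 * K\<close>.\<close>
  have "measure_pmf.prob (binomial_random_graph V p)
      {R. \<not> (\<exists>M \<subseteq> all_edges W \<inter> R. disjoint M \<and> card M = k)}
    \<le> (2 * 32) ^ k * exp (- p * (?n\<^sup>2 / 32) / 2)"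
  proof (rule prob_no_matching[OF V p])
    show "all_edges W \<subseteq> all_edges V" using W by (rule all_edges_mono)
    have "1 \<le> real (card W)" using W_large by linarith
    then have "real (card W) * (real (card W) - 1) \<le> ?n * ?n"
      using cardW by (intro mult_mono') auto
    moreover have "0 \<le> ?n * ?n" by simp
    ultimately show "real (card (all_edges W)) \<le> 32 * (?n\<^sup>2 / 32)"
      unfolding card_all_edges[OF finW] real_choose_2 power2_eq_square by linarith
    fix M assume M: "M \<subseteq> all_edges W" "disjoint M" "card M < k"
    have finM: "finite M" using M(1) finite_all_edges[OF finW] by (rule finite_subset)
    let ?U = "W - \<Union>M"
    have "card W - card (\<Union>M) \<le> card ?U" by (rule diff_card_le_card_Diff) (use M(1) finM finW in \<open>auto simp: all_edges_def intro: finite_subset\<close>)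
    then have "real (card W) - 2 * real k \<le> real (card ?U)"
      using card_Union_edges[OF M(1)] M(3) by linarith
    then have U: "?n / 4 \<le> real (card ?U) - 1" "?n / 4 \<le> real (card ?U)" using W_large by linarith+
    have "?n / 4 * (?n / 4) \<le> real (card ?U) * (real (card ?U) - 1)"
      using U by (intro mult_mono) auto
    then have "?n\<^sup>2 / 32 \<le> real (card (all_edges ?U))"
      using finW by (simp add: card_all_edges real_choose_2 power2_eq_square)
    also have "\<dots> \<le> real (card {e \<in> all_edges W. e \<inter> \<Union>M = {}})"
      by (intro of_nat_mono card_mono finite_subset[OF _ finite_all_edges[OF finW]])
         (auto simp: all_edges_def)
    finally show "?n\<^sup>2 / 32 \<le> real (card {e \<in> all_edges W. e \<inter> \<Union>M = {}})" .
  qed simp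
  then show ?thesis by simp
qed

lemma card_cross_edges:
  assumes "A \<inter> B = {}"
  shows "card ((\<lambda>(a, b). {a, b}) ` (A \<times> B)) = card A * card B"
proof -
  have "inj_on (\<lambda>(a, b). {a, b}) (A \<times> B)"
    using assms by (auto simp: inj_on_def doubleton_eq_iff)
  then show ?thesis by (simp add: card_image card_cartesian_product)
qed

text \<open>The constants are those of \<open>prob_no_matching_clique\<close>, so that both bounds
  can be merged later. A matching with fewer than two edges blocks at most one vertex on each
  side.\<close>

lemma prob_no_cross_matching:
  assumes V: "finite V" and p: "0 \<le> p" "p \<le> 1" and A: "A \<subseteq> V"
    and large: "real (card V) / 4 + 1 \<le> real (card A)" "real (card V) / 4 + 1 \<le> real (card (V - A))"
  defines "S \<equiv> (\<lambda>(a, b). {a, b}) ` (A \<times> (V - A))"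
  shows "measure_pmf.prob (binomial_random_graph V p)
      {R. \<not> (\<exists>M \<subseteq> S \<inter> R. disjoint M \<and> card M = 2)} \<le> 64 ^ 2 * exp (- p * (real (card V))\<^sup>2 / 64)"
proof -
  let ?n = "real (card V)" and ?B = "V - A"
  have fin: "finite A" "finite ?B" using A V finite_subset by auto
  have sub: "S \<subseteq> all_edges V" using A by (auto simp: S_def pair_in_all_edges)
  have finS: "finite S" using fin by (simp add: S_def)
  have "measure_pmf.prob (binomial_random_graph V p)
      {R. \<not> (\<exists>M \<subseteq> S \<inter> R. disjoint M \<and> card M = 2)} \<le> (2 * 32) ^ 2 * exp (- p * (?n\<^sup>2 / 32) / 2)"
  proof (rule prob_no_matching[OF V p sub])
    have "card A \<le> card V" "card ?B \<le> card V" using V A by (auto intro: card_mono)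
    then have "card A * card ?B \<le> card V * card V" by (rule mult_le_mono)
    then have "real (card S) \<le> ?n * ?n"
      unfolding S_def by (subst card_cross_edges) (auto simp flip: of_nat_mult)
    then show "real (card S) \<le> 32 * (?n\<^sup>2 / 32)" by (simp add: power2_eq_square)
    fix M assume M: "M \<subseteq> S" "disjoint M" "card M < 2"
    have "finite M" using M(1) finS by (rule finite_subset)
    then have "M = {} \<or> (\<exists>e. M = {e})" using M(3) by (auto simp: less_2_cases_iff card_1_singleton_iff)
    \<comment> \<open>For empty \<open>M\<close> two arbitrary vertices are removed, so that both
      cases share one count.\<close>
    then obtain a b where ab: "\<Union>M \<subseteq> {a, b}" "a \<in> A" "b \<in> ?B"
    proof
      assume "M = {}"
      have "card A \<noteq> 0" "card ?B \<noteq> 0" using large by (auto simp del: card_0_eq)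
      then obtain a b where "a \<in> A" "b \<in> ?B" by (metis card.empty all_not_in_conv)
      then show ?thesis using that \<open>M = {}\<close> by simp
    next
      assume "\<exists>e. M = {e}"
      then obtain e where e: "M = {e}" by blast
      then have "e \<in> S" using M(1) by simp
      then obtain a b where "e = {a, b}" "a \<in> A" "b \<in> ?B" unfolding S_def by auto
      then show ?thesis using that[of a b] e by simp
    qed
    let ?T = "(\<lambda>(a, b). {a, b}) ` ((A - {a}) \<times> (?B - {b}))"
    have "card ?T = card (A - {a}) * card (?B - {b})" by (rule card_cross_edges) auto
    also have "\<dots> = (card A - 1) * (card ?B - 1)" using ab fin by (simp add: card_Diff_singleton)
    finally have "real (card ?T) = (real (card A) - 1) * (real (card ?B) - 1)"
      using large by (simp add: of_nat_diff)
    moreover have "?n / 4 * (?n / 4) \<le> (real (card A) - 1) * (real (card ?B) - 1)"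
      using large by (intro mult_mono) auto
    ultimately have "?n\<^sup>2 / 16 \<le> real (card ?T)" by (simp add: power2_eq_square)
    moreover have "?n\<^sup>2 / 32 \<le> ?n\<^sup>2 / 16" by simp
    moreover have "card ?T \<le> card {e \<in> S. e \<inter> \<Union>M = {}}"
    proof (rule card_mono)
      show "finite {e \<in> S. e \<inter> \<Union>M = {}}"
        by (rule finite_subset[of _ S]) (use finS in auto)
      show "?T \<subseteq> {e \<in> S. e \<inter> \<Union>M = {}}"
        using ab by (auto simp: S_def)
    qed
    ultimately show "?n\<^sup>2 / 32 \<le> real (card {e \<in> S. e \<inter> \<Union>M = {}})" by linarith
  qed simp
  then show ?thesis by simp
qed

text \<open>Markov's inequality for the number of random edges in \<open>S\<close>, whose mean is
  \<open>card S * p\<close>.\<close>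

lemma prob_many_edges:
  assumes V: "finite V" and p: "0 \<le> p" "p \<le> 1" and S: "S \<subseteq> all_edges V" and k: "0 < k"
  shows "measure_pmf.prob (binomial_random_graph V p) {R. k \<le> real (card (R \<inter> S))}
    \<le> real (card S) * p / k"
proof -
  let ?M = "binomial_random_graph V p"
  have finS: "finite S" using S finite_all_edges[OF V] by (rule finite_subset)
  have card_eq: "real (card (R \<inter> S)) = (\<Sum>e\<in>S. indicator {R. e \<in> R} R)" for R
  proof -
    have "(\<Sum>e\<in>S. indicator {R. e \<in> R} R) = (\<Sum>e\<in>S. if e \<in> R then 1 else (0::real))"
      by (intro sum.cong) (auto simp: indicator_def)
    also have "\<dots> = real (card (R \<inter> S))"
      using finS by (simp add: sum.If_cases Int_commute)
    finally show ?thesis by simp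
  qed
  have prob_e: "measure_pmf.prob ?M {R. e \<in> R} = p" if "e \<in> S" for e
    using prob_contains_avoids[OF V p, of "{e}" "{}"] that S by auto
  have int1: "integrable ?M (indicator {R. e \<in> R} :: _ \<Rightarrow> real)" for e
    by (intro measure_pmf.integrable_const_bound[of _ 1]) (auto simp: indicator_def)
  have int: "integrable ?M (\<lambda>R. \<Sum>e\<in>S. indicator {R. e \<in> R} R :: real)"
    by (intro Bochner_Integration.integrable_sum int1)
  have "measure_pmf.prob ?M {R \<in> space ?M. k \<le> (\<Sum>e\<in>S. indicator {R. e \<in> R} R)}
    \<le> measure_pmf.expectation ?M (\<lambda>R. \<Sum>e\<in>S. indicator {R. e \<in> R} R) / k"
    by (rule integral_Markov_inequality_measure[OF int, of UNIV]) (use k in \<open>auto intro: sum_nonneg\<close>)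
  also have "measure_pmf.expectation ?M (\<lambda>R. \<Sum>e\<in>S. indicator {R. e \<in> R} R :: real)
    = (\<Sum>e\<in>S. measure_pmf.expectation ?M (indicator {R. e \<in> R}))"
    by (rule Bochner_Integration.integral_sum) (rule int1)
  also have "\<dots> = real (card S) * p" using prob_e by simp
  finally show ?thesis unfolding card_eq by simp
qed

section \<open>The threshold\<close>

lemma hamiltonian_mono:
  assumes "hamiltonian V E" "E \<subseteq> F"
  shows "hamiltonian V F"
proof -
  obtain c where c: "is_cycle E c" "set c = V" using assms(1) unfolding hamiltonian_def by blast
  have "is_cycle F c" using c(1) assms(2) unfolding is_cycle_def by auto
  then show ?thesis using c(2) unfolding hamiltonian_def by blast
qed

text \<open>Three disjoint sets of more than \<open>d\<close> vertices do not fit into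
  \<open>V\<close>. So either two disjoint ones together meet all the others, or any two intersect
  and at most one representative suffices.\<close>

lemma large_independent_representatives:
  assumes V: "finite V" and d: "card V < 3 * d + 3"
  obtains JJ where "finite JJ" "card JJ \<le> 2"
    "\<And>J. J \<in> JJ \<Longrightarrow> J \<subseteq> V \<and> independent_set E J \<and> d < card J"
    "\<And>I. \<lbrakk>I \<subseteq> V; independent_set E I; d < card I\<rbrakk> \<Longrightarrow> \<exists>J\<in>JJ. I \<inter> J \<noteq> {}"
proof -
  define II where "II = {I. I \<subseteq> V \<and> independent_set E I \<and> d < card I}"
  have "\<exists>JJ. finite JJ \<and> card JJ \<le> 2 \<and> JJ \<subseteq> II \<and> (\<forall>I\<in>II. \<exists>J\<in>JJ. I \<inter> J \<noteq> {})"
  proof (cases "\<exists>J\<in>II. \<exists>K\<in>II. J \<inter> K = {}")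
    case True
    then obtain J K where JK: "J \<in> II" "K \<in> II" "J \<inter> K = {}" by blast
    have "I \<inter> J \<noteq> {} \<or> I \<inter> K \<noteq> {}" if "I \<in> II" for I
    proof (rule ccontr)
      assume "\<not> ?thesis"
      then have disj: "I \<inter> (J \<union> K) = {}" by auto
      have sub: "I \<subseteq> V" "J \<subseteq> V" "K \<subseteq> V" using JK that by (auto simp: II_def)
      then have fin: "finite I" "finite J" "finite K" using V by (auto intro: finite_subset)
      have "card (I \<union> (J \<union> K)) = card I + (card J + card K)"
        using fin disj JK(3) by (simp add: card_Un_disjoint)
      moreover have "card (I \<union> (J \<union> K)) \<le> card V" using sub V by (intro card_mono) auto
      moreover have "d < card I" "d < card J" "d < card K" using JK that by (auto simp: II_def)
      ultimately show False using d by linarith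
    qed
    then show ?thesis using JK by (intro exI[of _ "{J, K}"]) (auto simp: card_insert_if)
  next
    case False
    then show ?thesis
    proof (cases "II = {}")
      case True
      then show ?thesis by (intro exI[of _ "{}"]) auto
    next
      case False
      then obtain J where "J \<in> II" by blast
      with \<open>\<not> (\<exists>J\<in>II. \<exists>K\<in>II. J \<inter> K = {})\<close> show ?thesis by (intro exI[of _ "{J}"]) auto
    qed
  qed
  then obtain JJ where "finite JJ" "card JJ \<le> 2" "JJ \<subseteq> II" "\<forall>I\<in>II. \<exists>J\<in>JJ. I \<inter> J \<noteq> {}" by blast
  then show ?thesis by (intro that[of JJ]) (auto simp: II_def)
qed

text \<open>A common vertex \<open>v\<close> has no neighbour in \<open>I \<union> J\<close>, so
  \<open>card (I \<union> J) <= card V - d\<close> and \<open>J - I\<close> has fewer than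
  \<open>card V - 2 * d\<close> vertices. If \<open>I\<close> were independent in \<open>R\<close>,
  every edge of \<open>M\<close> would have its own endpoint in \<open>J - I\<close>.\<close>

lemma matching_hits_independent:
  assumes V: "finite V" and E: "E \<subseteq> all_edges V"
    and deg: "\<And>v. v \<in> V \<Longrightarrow> d \<le> card (nbrs E v)"
    and I: "I \<subseteq> V" "independent_set E I" "d < card I"
    and J: "J \<subseteq> V" "independent_set E J" and IJ: "I \<inter> J \<noteq> {}"
    and M: "M \<subseteq> all_edges J \<inter> R" "disjoint M" "card M = card V - 2 * d"
  shows "\<not> independent_set R I"
proof
  assume ind: "independent_set R I"
  obtain v where v: "v \<in> I" "v \<in> J" using IJ by blast
  have fin: "finite I" "finite J" using I J V by (auto intro: finite_subset)
  have "nbrs E v \<inter> (I \<union> J) = {}"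
    using I(2) J(2) v by (auto simp: independent_set_def in_nbrs)
  moreover have "nbrs E v \<subseteq> V" using nbrs_subset[OF E, of v] by auto
  ultimately have "card (nbrs E v) + card (I \<union> J) \<le> card V"
    using V fin I(1) J(1) card_mono[of V "nbrs E v \<union> (I \<union> J)"] finite_subset[of "nbrs E v" V]
    by (simp add: card_Un_disjoint)
  moreover have "card (I \<union> J) = card I + card (J - I)"
    using fin card_Un_disjoint[of I "J - I"] by auto
  ultimately have lt: "card (J - I) < card V - 2 * d"
    using deg[of v] v I by auto
  have "\<exists>x. x \<in> e \<inter> (J - I)" if e: "e \<in> M" for e
  proof -
    have "e \<in> all_edges J" "e \<in> R" using e M(1) by auto
    then obtain a b where ab: "e = {a, b}" "a \<in> J" "b \<in> J" by (auto elim: all_edgesE)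
    then show ?thesis using ind \<open>e \<in> R\<close> unfolding independent_set_def by auto
  qed
  then obtain f where f: "\<And>e. e \<in> M \<Longrightarrow> f e \<in> e \<inter> (J - I)" by metis
  have "inj_on f M"
  proof (rule inj_onI)
    fix e e' assume "e \<in> M" "e' \<in> M" "f e = f e'"
    then show "e = e'" using f[of e] f[of e'] disjointD[OF M(2), of e e'] by auto
  qed
  moreover have "f ` M \<subseteq> J - I" using f by auto
  ultimately have "card M \<le> card (J - I)" using fin by (intro card_inj_on_le) auto
  then show False using lt M(3) by simp
qed

text \<open>Failure means that some representative \<open>J\<close> contains no random matching of
  size \<open>card V - 2 * d\<close>; there are at most two representatives, whence the factor
  2.\<close>

lemma prob_nonhamiltonian_connected:
  fixes V :: "'a set"
  assumes V: "finite V" and H: "H \<subseteq> all_edges V"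
    and deg: "\<And>v. v \<in> V \<Longrightarrow> d \<le> card (nbrs H v)"
    and d: "31 * card V \<le> 64 * d" "2 * d < card V" and n: "32 \<le> card V"
    and p: "0 \<le> p" "p \<le> 1"
    and sep: "\<And>X Y. \<lbrakk>X \<subseteq> V; Y \<subseteq> V; separated H X Y; d \<le> card X; d \<le> Suc (card Y)\<rbrakk> \<Longrightarrow> False"
  shows "measure_pmf.prob (binomial_random_graph V p) {R. \<not> hamiltonian V (H \<union> R)}
    \<le> 2 * (64 ^ (card V - 2 * d) * exp (- p * (real (card V))\<^sup>2 / 64))"
proof -
  let ?P = "measure_pmf.prob (binomial_random_graph V p)" and ?k = "card V - 2 * d"
  let ?bound = "64 ^ ?k * exp (- p * (real (card V))\<^sup>2 / 64)"
  have d3: "card V < 3 * d + 3" using d n by linarith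
  obtain JJ where JJ: "finite JJ" "card JJ \<le> 2"
    "\<And>J. J \<in> JJ \<Longrightarrow> J \<subseteq> V \<and> independent_set H J \<and> d < card J"
    "\<And>I. \<lbrakk>I \<subseteq> V; independent_set H I; d < card I\<rbrakk> \<Longrightarrow> \<exists>J\<in>JJ. I \<inter> J \<noteq> {}"
    using large_independent_representatives[OF V d3, of H] by metis
  define B where "B = (\<lambda>J :: 'a set. {R. \<not> (\<exists>M \<subseteq> all_edges J \<inter> R. disjoint M \<and> card M = ?k)})"
  have "{R. \<not> hamiltonian V (H \<union> R)} \<subseteq> (\<Union>J\<in>JJ. B J)"
  proof (rule ccontr)
    assume "\<not> ?thesis"
    then obtain R where R: "\<not> hamiltonian V (H \<union> R)" "\<And>J. J \<in> JJ \<Longrightarrow> R \<notin> B J" by auto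
    \<comment> \<open>\<open>R\<close> ranges over arbitrary edge sets, whereas
      \<open>hamiltonian_of_small_independence\<close> needs a simple graph on
      \<open>V\<close>.\<close>
    let ?E = "H \<union> (R \<inter> all_edges V)"
    have "hamiltonian V ?E"
    proof (rule hamiltonian_of_small_independence[OF V])
      show "?E \<subseteq> all_edges V" using H by auto
      show "d \<le> card (nbrs ?E v)" if "v \<in> V" for v
      proof -
        have "finite (nbrs ?E v)"
          using nbrs_subset[of ?E V v] H V by (meson Int_lower2 Un_least finite_Diff finite_subset)
        then have "card (nbrs H v) \<le> card (nbrs ?E v)"
          by (rule card_mono) (rule nbrs_mono, simp)
        then show ?thesis using deg[OF that] by simp
      qed
      show "3 * card V < 7 * d" using d n by linarith
      show "7 \<le> card V" using n by simp
      show False if XY: "X \<subseteq> V" "Y \<subseteq> V" "separated ?E X Y" "d \<le> card X" "d \<le> Suc (card Y)" for X Y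
      proof -
        have "separated H X Y" using XY(3) by (auto simp: separated_def)
        then show False using sep[OF XY(1,2) _ XY(4,5)] by simp
      qed
      show "card I \<le> d" if I: "I \<subseteq> V" "independent_set ?E I" for I
      proof (rule ccontr)
        assume "\<not> card I \<le> d"
        then have "d < card I" by simp
        moreover have indH: "independent_set H I" and indR: "independent_set (R \<inter> all_edges V) I"
          using I(2) by (auto simp: independent_set_def)
        ultimately obtain J where J: "J \<in> JJ" "I \<inter> J \<noteq> {}" using JJ(4)[OF I(1)] by auto
        obtain M where M: "M \<subseteq> all_edges J \<inter> R" "disjoint M" "card M = ?k"
          using R(2)[OF J(1)] unfolding B_def by auto
        have "M \<subseteq> all_edges J \<inter> (R \<inter> all_edges V)"
          using M(1) all_edges_mono[of J V] JJ(3)[OF J(1)] by auto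
        then show False
          using matching_hits_independent[OF V H deg I(1) indH \<open>d < card I\<close> _ _ J(2) _ M(2,3)]
            indR JJ(3)[OF J(1)] by blast
      qed
    qed
    then have "hamiltonian V (H \<union> R)" by (rule hamiltonian_mono) auto
    with R(1) show False ..
  qed
  then have "?P {R. \<not> hamiltonian V (H \<union> R)} \<le> ?P (\<Union>J\<in>JJ. B J)"
    by (rule measure_pmf.finite_measure_mono) simp
  also have "\<dots> \<le> (\<Sum>J\<in>JJ. ?P (B J))"
    by (rule measure_pmf.finite_measure_subadditive_finite[OF JJ(1)]) simp
  also have "\<dots> \<le> (\<Sum>J\<in>JJ. ?bound)"
  proof (rule sum_mono)
    fix J assume "J \<in> JJ"
    then have J: "J \<subseteq> V" "d < card J" using JJ(3) by auto
    \<comment> \<open>Here \<open>card J - 2 * ?k\<close> is at least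
      \<open>5 * d + 1 - 2 * card V\<close>, and \<open>31 * card V <= 64 * d\<close> makes this at
      least \<open>27 * card V / 64 + 1\<close>.\<close>
    have "real ?k = real (card V) - 2 * real d" using d by (simp add: of_nat_diff)
    moreover have "real d + 1 \<le> real (card J)" using J(2) by linarith
    moreover have "31 * real (card V) \<le> 64 * real d" using d(1) by linarith
    ultimately have "real (card V) / 4 + 1 \<le> real (card J) - 2 * real ?k" by linarith
    then show "?P (B J) \<le> ?bound"
      unfolding B_def by (rule prob_no_matching_clique[OF V p J(1)])
  qed
  also have "\<dots> = real (card JJ) * ?bound" by simp
  also have "\<dots> \<le> 2 * ?bound" using JJ(2) by (intro mult_right_mono) auto
  finally show ?thesis .
qed

text \<open>Two disjoint random edges across the partition have four distinct ends, and spanning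
  paths of the two sides between these ends close the cycle.\<close>

lemma prob_nonhamiltonian_separated:
  assumes V: "finite V" and H: "H \<subseteq> all_edges V"
    and deg: "\<And>v. v \<in> V \<Longrightarrow> d \<le> card (nbrs H v)"
    and d: "31 * card V \<le> 64 * d" and n: "32 \<le> card V"
    and p: "0 \<le> p" "p \<le> 1"
    and XY: "X \<subseteq> V" "Y \<subseteq> V" "separated H X Y" "d \<le> card X" "d \<le> Suc (card Y)"
  shows "measure_pmf.prob (binomial_random_graph V p) {R. \<not> hamiltonian V (H \<union> R)}
    \<le> 64 ^ 2 * exp (- p * (real (card V))\<^sup>2 / 64)"
proof -
  let ?P = "measure_pmf.prob (binomial_random_graph V p)"
  have d8: "3 * card V + 8 \<le> 7 * d" using d n by linarith
  obtain A where A: "A \<subseteq> V" "d \<le> Suc (card A)" "d \<le> Suc (card (V - A))"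
    "\<And>a b. a \<in> A \<Longrightarrow> b \<in> A \<Longrightarrow> a \<noteq> b \<Longrightarrow> spanning_path A H a b"
    "\<And>a b. a \<in> V - A \<Longrightarrow> b \<in> V - A \<Longrightarrow> a \<noteq> b \<Longrightarrow> spanning_path (V - A) H a b"
    using partition_of_separated[OF V H deg d8 XY] by metis
  define S where "S = (\<lambda>(a, b). {a, b}) ` (A \<times> (V - A))"
  define B where "B = {R. \<not> (\<exists>M \<subseteq> S \<inter> R. disjoint M \<and> card M = 2)}"
  have "{R. \<not> hamiltonian V (H \<union> R)} \<subseteq> B"
  proof (rule ccontr)
    assume "\<not> ?thesis"
    then obtain R where R: "\<not> hamiltonian V (H \<union> R)" "R \<notin> B" by auto
    then obtain M where M: "M \<subseteq> S \<inter> R" "disjoint M" "card M = 2" unfolding B_def by auto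
    obtain e f where ef: "M = {e, f}" "e \<noteq> f" using M(3) unfolding card_2_iff by auto
    have eS: "e \<in> S" "e \<in> R" "f \<in> S" "f \<in> R" using M(1) ef by auto
    obtain a1 b1 where e: "e = {a1, b1}" "a1 \<in> A" "b1 \<in> V - A" using eS(1) unfolding S_def by auto
    obtain a2 b2 where f: "f = {a2, b2}" "a2 \<in> A" "b2 \<in> V - A" using eS(3) unfolding S_def by auto
    have "e \<inter> f = {}" using disjointD[OF M(2), of e f] ef by simp
    then have ne: "a1 \<noteq> a2" "b2 \<noteq> b1" using e f by auto
    have "hamiltonian V (H \<union> R)"
    proof (rule hamiltonian_of_partition)
      show "spanning_path A (H \<union> R) a1 a2"
        by (rule spanning_path_mono[OF A(4)[OF e(2) f(2) ne(1)]]) simp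
      show "spanning_path (V - A) (H \<union> R) b2 b1"
        by (rule spanning_path_mono[OF A(5)[OF f(3) e(3) ne(2)]]) simp
      show "{a1, b1} \<in> H \<union> R" "{a2, b2} \<in> H \<union> R" using eS e f by auto
    qed (use A(1) e f n in auto)
    with R(1) show False ..
  qed
  then have "?P {R. \<not> hamiltonian V (H \<union> R)} \<le> ?P B"
    by (rule measure_pmf.finite_measure_mono) simp
  also have "\<dots> \<le> 64 ^ 2 * exp (- p * (real (card V))\<^sup>2 / 64)"
    unfolding B_def S_def
  proof (rule prob_no_cross_matching[OF V p A(1)])
    have "31 * real (card V) \<le> 64 * real d" "32 \<le> real (card V)" using d n by linarith+
    moreover have "real d \<le> 1 + real (card A)" "real d \<le> 1 + real (card (V - A))"
      using A(2,3) by linarith+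
    ultimately show "real (card V) / 4 + 1 \<le> real (card A)"
      "real (card V) / 4 + 1 \<le> real (card (V - A))" by linarith+
  qed
  finally show ?thesis .
qed

text \<open>The exponent is doubled to cover both cases: \<open>card V - 2 * d\<close> is at least
  1, so the power also dominates the \<open>64 ^ 2\<close> of the separated case.\<close>

lemma prob_nonhamiltonian:
  assumes V: "finite V" and H: "H \<subseteq> all_edges V"
    and deg: "\<And>v. v \<in> V \<Longrightarrow> d \<le> card (nbrs H v)"
    and d: "31 * card V \<le> 64 * d" "2 * d < card V" and n: "32 \<le> card V"
    and p: "0 \<le> p" "p \<le> 1"
  shows "measure_pmf.prob (binomial_random_graph V p) {R. \<not> hamiltonian V (H \<union> R)}
    \<le> 2 * 64 ^ (2 * (card V - 2 * d)) * exp (- p * (real (card V))\<^sup>2 / 64)"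
proof -
  let ?k = "card V - 2 * d" and ?e = "exp (- p * (real (card V))\<^sup>2 / 64)"
  let ?P = "measure_pmf.prob (binomial_random_graph V p) {R. \<not> hamiltonian V (H \<union> R)}"
  show ?thesis
  proof (cases "\<exists>X Y. X \<subseteq> V \<and> Y \<subseteq> V \<and> separated H X Y \<and> d \<le> card X \<and> d \<le> Suc (card Y)")
    case True
    then obtain X Y where XY: "X \<subseteq> V" "Y \<subseteq> V" "separated H X Y" "d \<le> card X" "d \<le> Suc (card Y)"
      by blast
    have "?P \<le> 64 ^ 2 * ?e" by (rule prob_nonhamiltonian_separated[OF V H deg d(1) n p XY])
    also have "\<dots> \<le> 2 * 64 ^ 2 * ?e" by simp
    also have "\<dots> \<le> 2 * 64 ^ (2 * ?k) * ?e"
      using d(2) by (intro mult_right_mono mult_left_mono power_increasing) auto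
    finally show ?thesis .
  next
    case False
    have "?P \<le> 2 * (64 ^ ?k * ?e)"
      by (rule prob_nonhamiltonian_connected[OF V H deg d n p]) (use False in auto)
    also have "\<dots> \<le> 2 * (64 ^ (2 * ?k) * ?e)"
      by (intro mult_right_mono mult_left_mono power_increasing) auto
    finally show ?thesis by simp
  qed
qed

text \<open>Each vertex of \<open>A\<close> follows only one position of the cycle, so at least
  \<open>card V - 2 * card A\<close> vertices of \<open>V - A\<close> are followed by another one.
  The edges used there must come from \<open>R\<close>.\<close>

lemma hamiltonian_over_bipartite:
  assumes V: "finite V" and A: "A \<subseteq> V"
    and ham: "hamiltonian V ((\<lambda>(a, b). {a, b}) ` (A \<times> (V - A)) \<union> R)"
  shows "card V \<le> card (R \<inter> all_edges (V - A)) + 2 * card A"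
proof -
  let ?B = "V - A"
  obtain c where c: "is_cycle ((\<lambda>(a, b). {a, b}) ` (A \<times> ?B) \<union> R) c" "set c = V"
    using ham unfolding hamiltonian_def by blast
  let ?m = "length c"
  have m: "3 \<le> ?m" and dist: "distinct c"
    and edge: "\<And>i. i < ?m \<Longrightarrow> {c ! i, c ! (Suc i mod ?m)} \<in> (\<lambda>(a, b). {a, b}) ` (A \<times> ?B) \<union> R"
    using c(1) by (auto simp: is_cycle_def)
  have c0: "c \<noteq> []" using m by auto
  have Suc_mod: "Suc i mod ?m < ?m" for i using c0 by simp
  \<comment> \<open>\<open>rotate1\<close> puts the successor of position \<open>i\<close> at index
    \<open>i\<close>; \<open>T\<close> collects the positions where the cycle stays in
    \<open>?B\<close>.\<close>
  define T where "T = positions c ?B - positions (rotate1 c) A"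
  have T: "i < ?m" "c ! i \<in> ?B" "c ! (Suc i mod ?m) \<in> ?B" if "i \<in> T" for i
    using that c(2) nth_mem[OF Suc_mod, of i] by (auto simp: T_def positions_def nth_rotate1)
  have "card (positions c ?B) = card V - card A"
    using card_positions[OF dist, of ?B] c(2) A V
    by (simp add: Int_absorb1 Int_Diff card_Diff_subset finite_subset)
  moreover have "card (positions (rotate1 c) A) = card A"
    using card_positions[of "rotate1 c" A] dist c(2) A by (simp add: Int_absorb1)
  ultimately have "card V - card A - card A \<le> card T"
    using diff_card_le_card_Diff[of "positions (rotate1 c) A" "positions c ?B"] by (simp add: T_def)
  moreover have "card T \<le> card (R \<inter> all_edges ?B)"
  proof (rule card_inj_on_le)
    show "finite (R \<inter> all_edges ?B)" using finite_all_edges[of ?B] V by simp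
    show "inj_on (\<lambda>i. {c ! i, c ! (Suc i mod ?m)}) T"
    proof (rule inj_onI)
      fix i j assume ij: "i \<in> T" "j \<in> T"
        and eq: "{c ! i, c ! (Suc i mod ?m)} = {c ! j, c ! (Suc j mod ?m)}"
      have lt: "i < ?m" "j < ?m" using T ij by auto
      \<comment> \<open>Traversing one edge in both directions would need a cycle of length 2, so
        \<open>m\<close> leaves only \<open>i = j\<close>.\<close>
      have "i = j \<or> i = Suc j mod ?m \<and> Suc i mod ?m = j"
        using eq lt Suc_mod nth_eq_iff_index_eq[OF dist] by (auto simp: doubleton_eq_iff)
      then show "i = j" using lt m by (auto simp: mod_Suc split: if_splits)
    qed
    show "(\<lambda>i. {c ! i, c ! (Suc i mod ?m)}) ` T \<subseteq> R \<inter> all_edges ?B"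
    proof (rule image_subsetI)
      fix i assume i: "i \<in> T"
      have "Suc i mod ?m \<noteq> i" using T(1)[OF i] m by (auto simp: mod_Suc)
      then have "c ! i \<noteq> c ! (Suc i mod ?m)"
        using nth_eq_iff_index_eq[OF dist T(1)[OF i] Suc_mod] by auto
      then have "{c ! i, c ! (Suc i mod ?m)} \<in> all_edges ?B"
        using T[OF i] by (simp add: pair_in_all_edges)
      moreover have "{c ! i, c ! (Suc i mod ?m)} \<notin> (\<lambda>(a, b). {a, b}) ` (A \<times> ?B)"
        using T(2,3)[OF i] by (auto simp: doubleton_eq_iff)
      ultimately show "{c ! i, c ! (Suc i mod ?m)} \<in> R \<inter> all_edges ?B"
        using edge[OF T(1)[OF i]] by auto
    qed
  qed
  ultimately show ?thesis by linarith
qed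

text \<open>A first-moment bound: Hamiltonicity forces \<open>card V - 2 * card A\<close> random
  edges inside \<open>V - A\<close>, where fewer than \<open>(card V)^2 * p\<close> are expected
  when \<open>p > 0\<close>.\<close>

lemma prob_hamiltonian_over_bipartite:
  assumes V: "finite V" and A: "A \<subseteq> V" "2 * card A < card V" and p: "0 \<le> p" "p \<le> 1"
  shows "measure_pmf.prob (binomial_random_graph V p)
      {R. hamiltonian V ((\<lambda>(a, b). {a, b}) ` (A \<times> (V - A)) \<union> R)}
    \<le> (real (card V))\<^sup>2 * p / (real (card V) - 2 * real (card A))"
proof -
  let ?P = "measure_pmf.prob (binomial_random_graph V p)"
  let ?k = "real (card V) - 2 * real (card A)" and ?S = "all_edges (V - A)"
  have k: "0 < ?k" using A(2) by linarith
  have "{R. hamiltonian V ((\<lambda>(a, b). {a, b}) ` (A \<times> (V - A)) \<union> R)}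
      \<subseteq> {R. ?k \<le> real (card (R \<inter> ?S))}"
    using hamiltonian_over_bipartite[OF V A(1)] by force
  then have "?P {R. hamiltonian V ((\<lambda>(a, b). {a, b}) ` (A \<times> (V - A)) \<union> R)}
      \<le> ?P {R. ?k \<le> real (card (R \<inter> ?S))}"
    by (rule measure_pmf.finite_measure_mono) simp
  also have "\<dots> \<le> real (card ?S) * p / ?k"
    by (rule prob_many_edges[OF V p all_edges_mono k]) auto
  also have "\<dots> \<le> (real (card V))\<^sup>2 * p / ?k"
  proof -
    have "card ?S \<le> card (all_edges V)"
      by (rule card_mono[OF finite_all_edges[OF V] all_edges_mono]) auto
    also have "\<dots> = card V choose 2" by (rule card_all_edges[OF V])
    finally have "real (card ?S) \<le> real (card V) * (real (card V) - 1) / 2"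
      by (simp flip: real_choose_2)
    also have "\<dots> \<le> (real (card V))\<^sup>2" by (simp add: power2_eq_square algebra_simps)
    finally show ?thesis using k p by (intro divide_right_mono mult_right_mono) auto
  qed
  finally show ?thesis .
qed

lemma min_degree_bipartite:
  assumes V: "finite V" "V \<noteq> {}" and A: "A \<subseteq> V" "2 * card A \<le> card V"
  shows "card A \<le> min_degree V ((\<lambda>(a, b). {a, b}) ` (A \<times> (V - A)))"
proof -
  let ?E = "(\<lambda>(a, b). {a, b}) ` (A \<times> (V - A))"
  have E: "?E \<subseteq> all_edges V" using A by (auto simp: pair_in_all_edges)
  have "card A \<le> vertex_degree ?E v" if v: "v \<in> V" for v
  proof (cases "v \<in> A")
    case True
    then have "nbrs ?E v = V - A"
      by (auto simp: nbrs_def image_iff doubleton_eq_iff)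
    then show ?thesis
      using A V by (simp add: vertex_degree_eq_card_nbrs[OF E] card_Diff_subset finite_subset)
  next
    case False
    then have "nbrs ?E v = A"
      using v by (auto simp: nbrs_def image_iff doubleton_eq_iff)
    then show ?thesis by (simp add: vertex_degree_eq_card_nbrs[OF E])
  qed
  then show ?thesis unfolding min_degree_def using V by simp
qed

lemma nbrs_ge_min_degree:
  assumes "simple_graph V E" "v \<in> V"
  shows "min_degree V E \<le> card (nbrs E v)"
proof -
  have "min_degree V E \<le> vertex_degree E v"
    unfolding min_degree_def using assms by (intro Min_le) (auto simp: simple_graph_def)
  then show ?thesis using assms(1) vertex_degree_eq_card_nbrs[of E V v] by (simp add: simple_graph_def)
qed

text \<open>The two bounds on \<open>\<eta>\<close> contradict each other for \<open>n < 32\<close>,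
  which is why the hypotheses on \<open>d\<close> and \<open>\<eta>\<close> start at some
  \<open>n0\<close>.\<close>

theorem theorem1p2:
  fixes d :: "nat \<Rightarrow> nat" and \<eta> :: "nat \<Rightarrow> real" and n0 :: nat
  assumes "\<And>n. n \<ge> n0 \<Longrightarrow> real (d n) = real n / 2 - \<eta> n"
    and "\<And>n. n \<ge> n0 \<Longrightarrow> 1 / 2 \<le> \<eta> n \<and> \<eta> n \<le> real n / 64"
  shows "(\<exists>H :: nat \<Rightarrow> nat set set.
            (\<forall>n. simple_graph {..<n} (H n)) \<and>
            (\<forall>n\<ge>n0. min_degree {..<n} (H n) \<ge> d n) \<and>
            (\<forall>p :: nat \<Rightarrow> real. (\<forall>n. 0 \<le> p n \<and> p n \<le> 1) \<longrightarrow>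
               p \<in> o(\<lambda>n. \<eta> n / (real n)\<^sup>2) \<longrightarrow>
               (\<lambda>n. prob_union_hamiltonian n (H n) (p n)) \<longlonglongrightarrow> 0))
       \<and> (\<forall>H :: nat \<Rightarrow> nat set set.
            (\<forall>n. simple_graph {..<n} (H n)) \<longrightarrow>
            (\<forall>n\<ge>n0. min_degree {..<n} (H n) \<ge> d n) \<longrightarrow>
            (\<forall>p :: nat \<Rightarrow> real. (\<forall>n. 0 \<le> p n \<and> p n \<le> 1) \<longrightarrow>
               p \<in> \<omega>(\<lambda>n. \<eta> n / (real n)\<^sup>2) \<longrightarrow>
               (\<lambda>n. prob_union_hamiltonian n (H n) (p n)) \<longlonglongrightarrow> 1))"
proof (intro conjI)
  \<comment> \<open>\<open>n - 2 * d n\<close> is both the imbalance of the bipartite graph and the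
    matching size of the upper bound; it is traded for \<open>2 * \<eta> n\<close> here.\<close>
  have d_eq: "2 * \<eta> n = real n - 2 * real (d n)" if "n \<ge> n0" for n using assms(1)[OF that] by simp
  have \<eta>: "1 / 2 \<le> \<eta> n" "\<eta> n \<le> real n / 64" if "n \<ge> n0" for n using assms(2)[OF that] by auto
  have n32: "32 \<le> n" if "n \<ge> n0" for n using \<eta>[OF that] by linarith
  have d2: "2 * d n < n" if "n \<ge> n0" for n using d_eq[OF that] \<eta>[OF that] by linarith
  have d31: "31 * n \<le> 64 * d n" if "n \<ge> n0" for n using d_eq[OF that] \<eta>[OF that] by linarith
  let ?K = "\<lambda>n. (\<lambda>(a, b). {a, b}) ` ({..<d n} \<times> ({..<n} - {..<d n}))"
  \<comment> \<open>Below \<open>n0\<close> nothing relates \<open>d n\<close> to \<open>n\<close>;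
    the empty graph keeps \<open>H n\<close> simple there.\<close>
  define H where "H = (\<lambda>n. if n \<ge> n0 then ?K n else {})"
  have "simple_graph {..<n} (H n)" for n
    using d2[of n] by (auto simp: H_def simple_graph_def pair_in_all_edges)
  moreover have "d n \<le> min_degree {..<n} (H n)" if "n \<ge> n0" for n
    using min_degree_bipartite[of "{..<n}" "{..<d n}"] n32[OF that] d2[OF that] that
    by (auto simp: H_def)
  moreover have "(\<lambda>n. prob_union_hamiltonian n (H n) (p n)) \<longlonglongrightarrow> 0"
    if p01: "\<And>n. 0 \<le> p n \<and> p n \<le> 1" and p: "p \<in> o(\<lambda>n. \<eta> n / (real n)\<^sup>2)" for p
  proof (rule tendstoI)
    fix \<epsilon> :: real assume "\<epsilon> > 0"
    have "\<forall>\<^sub>F n in sequentially. norm (p n) \<le> \<epsilon> * norm (\<eta> n / (real n)\<^sup>2)"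
      by (rule landau_o.smallD[OF p \<open>\<epsilon> > 0\<close>])
    then show "\<forall>\<^sub>F n in sequentially. dist (prob_union_hamiltonian n (H n) (p n)) 0 < \<epsilon>"
      using eventually_ge_at_top[of n0]
    proof eventually_elim
      case (elim n)
      have pos: "0 < real n" using n32[OF elim(2)] by simp
      have "prob_union_hamiltonian n (H n) (p n)
          \<le> (real n)\<^sup>2 * p n / (real n - 2 * real (d n))"
        using prob_hamiltonian_over_bipartite[of "{..<n}" "{..<d n}" "p n"] d2[OF elim(2)] p01[of n]
        by (simp add: prob_union_hamiltonian_def H_def elim(2))
      also have "\<dots> = (real n)\<^sup>2 * p n / (2 * \<eta> n)" using d_eq[OF elim(2)] by simp
      \<comment> \<open>The factor 2 in \<open>2 * \<eta> n\<close> provides the slack for a strict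
        inequality.\<close>
      also have "\<dots> \<le> \<epsilon> / 2"
      proof -
        have "p n \<le> \<epsilon> * (\<eta> n / (real n)\<^sup>2)" using elim(1) p01[of n] \<eta>[OF elim(2)] by simp
        then have "(real n)\<^sup>2 * p n \<le> \<epsilon> * \<eta> n" using pos by (simp add: field_simps)
        then show ?thesis using \<eta>[OF elim(2)] by (simp add: field_simps)
      qed
      finally show ?case using \<open>\<epsilon> > 0\<close> by (simp add: prob_union_hamiltonian_def)
    qed
  qed
  ultimately show "\<exists>H :: nat \<Rightarrow> nat set set.
            (\<forall>n. simple_graph {..<n} (H n)) \<and>
            (\<forall>n\<ge>n0. min_degree {..<n} (H n) \<ge> d n) \<and>
            (\<forall>p :: nat \<Rightarrow> real. (\<forall>n. 0 \<le> p n \<and> p n \<le> 1) \<longrightarrow>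
               p \<in> o(\<lambda>n. \<eta> n / (real n)\<^sup>2) \<longrightarrow>
               (\<lambda>n. prob_union_hamiltonian n (H n) (p n)) \<longlonglongrightarrow> 0)"
    by (intro exI[of _ H]) auto
  show "\<forall>H :: nat \<Rightarrow> nat set set.
            (\<forall>n. simple_graph {..<n} (H n)) \<longrightarrow>
            (\<forall>n\<ge>n0. min_degree {..<n} (H n) \<ge> d n) \<longrightarrow>
            (\<forall>p :: nat \<Rightarrow> real. (\<forall>n. 0 \<le> p n \<and> p n \<le> 1) \<longrightarrow>
               p \<in> \<omega>(\<lambda>n. \<eta> n / (real n)\<^sup>2) \<longrightarrow>
               (\<lambda>n. prob_union_hamiltonian n (H n) (p n)) \<longlonglongrightarrow> 1)"
  proof (intro allI impI tendstoI)
    fix H :: "nat \<Rightarrow> nat set set" and p :: "nat \<Rightarrow> real" and \<epsilon> :: real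
    assume simple: "\<forall>n. simple_graph {..<n} (H n)"
      and deg: "\<forall>n\<ge>n0. d n \<le> min_degree {..<n} (H n)"
      and p01: "\<forall>n. 0 \<le> p n \<and> p n \<le> 1" and p: "p \<in> \<omega>(\<lambda>n. \<eta> n / (real n)\<^sup>2)"
      and "\<epsilon> > 0"
    obtain s :: real where s: "0 < s" "2 * exp (- s) < \<epsilon>"
    proof
      \<comment> \<open>The maximum with 1 ensures positivity; the summand 1 before the logarithm
        ensures strictness.\<close>
      let ?s = "max 1 (1 - ln (\<epsilon> / 2))"
      show "0 < ?s" by simp
      have "exp (- ?s) < exp (ln (\<epsilon> / 2))" by simp
      then show "2 * exp (- ?s) < \<epsilon>" using \<open>\<epsilon> > 0\<close> by simp
    qed
    \<comment> \<open>After division by 64, the part \<open>4 * ln 64\<close> cancels the factor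
      \<open>64 ^ (2 * (n - 2 * d n)) = exp (4 * \<eta> n * ln 64)\<close>. The part
      \<open>2 * s\<close> leaves the exponent \<open>- 2 * s * \<eta> n\<close>, at most
      \<open>- s\<close> because \<open>\<eta> n >= 1 / 2\<close>.\<close>
    define C :: real where "C = 64 * (4 * ln 64 + 2 * s)"
    have "\<forall>\<^sub>F n in sequentially. C * norm (\<eta> n / (real n)\<^sup>2) \<le> norm (p n)"
      by (rule smallomegaD[OF p])
    then show "\<forall>\<^sub>F n in sequentially. dist (prob_union_hamiltonian n (H n) (p n)) 1 < \<epsilon>"
      using eventually_ge_at_top[of n0]
    proof eventually_elim
      case (elim n)
      note \<eta>n = \<eta>[OF elim(2)]
      let ?V = "{..<n}"
      let ?P = "measure_pmf.prob (binomial_random_graph ?V (p n))"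
      have pos: "0 < real n" using n32[OF elim(2)] by simp
      have "C * (\<eta> n / (real n)\<^sup>2) \<le> p n" using elim(1) p01[rule_format, of n] \<eta>n by simp
      then have pn: "C * \<eta> n \<le> p n * (real n)\<^sup>2" using pos by (simp add: field_simps)
      have "?P {R. \<not> hamiltonian ?V (H n \<union> R)}
          \<le> 2 * 64 ^ (2 * (card ?V - 2 * d n)) * exp (- p n * (real (card ?V))\<^sup>2 / 64)"
      proof (rule prob_nonhamiltonian)
        show "H n \<subseteq> all_edges ?V" using simple by (simp add: simple_graph_def)
        show "d n \<le> card (nbrs (H n) v)" if "v \<in> ?V" for v
          using nbrs_ge_min_degree[OF simple[rule_format] that] deg elim(2) le_trans by blast
      qed (use p01 d31[OF elim(2)] d2[OF elim(2)] n32[OF elim(2)] in auto)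
      also have "64 ^ (2 * (card ?V - 2 * d n)) = exp (4 * \<eta> n * ln 64)"
      proof -
        have "real (2 * (card ?V - 2 * d n)) = 4 * \<eta> n"
          using d2[OF elim(2)] d_eq[OF elim(2)] by (simp add: of_nat_diff)
        moreover have "(64::real) ^ (2 * (card ?V - 2 * d n))
            = exp (real (2 * (card ?V - 2 * d n)) * ln 64)"
          by (simp only: exp_of_nat_mult) simp
        ultimately show ?thesis by simp
      qed
      also have "2 * exp (4 * \<eta> n * ln 64) * exp (- p n * (real (card ?V))\<^sup>2 / 64)
          = 2 * exp (4 * \<eta> n * ln 64 - p n * (real n)\<^sup>2 / 64)"
        by (simp add: mult.assoc flip: exp_add)
      also have "\<dots> \<le> 2 * exp (- s)"
      proof -
        have "4 * \<eta> n * ln 64 - p n * (real n)\<^sup>2 / 64 \<le> 4 * \<eta> n * ln 64 - C * \<eta> n / 64"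
          using pn by simp
        also have "\<dots> = - (s * (2 * \<eta> n))" by (simp add: C_def field_simps)
        also have "\<dots> \<le> - s" using s(1) \<eta>n by simp
        finally show ?thesis by simp
      qed
      finally have "?P {R. \<not> hamiltonian ?V (H n \<union> R)} < \<epsilon>" using s(2) by simp
      moreover have "?P {R. \<not> hamiltonian ?V (H n \<union> R)} = 1 - prob_union_hamiltonian n (H n) (p n)"
        using measure_pmf.prob_compl[of "{R. hamiltonian ?V (H n \<union> R)}" "binomial_random_graph ?V (p n)"]
        by (simp add: prob_union_hamiltonian_def Compl_eq_Diff_UNIV[symmetric] Collect_neg_eq[symmetric])
      moreover have "prob_union_hamiltonian n (H n) (p n) \<le> 1"
        by (simp add: prob_union_hamiltonian_def)
      ultimately show ?case by (simp add: dist_real_def)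
    qed
  qed
qed

end
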